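(* Let $n\in\mathbb N$ and $d\in(0,n)$. Let $\mu$ be the $d$-dimensional Minkowski content measure on $S\in\mathcal M$, where $\mathcal M$ is the family of subsets of $\mathbb R^n$ that can be expressed as the intersection of an open set with a closed set, and suppose $S$ is relatively closed in an open set $G\subset\mathbb R^n$. Let $\phi:G\to\mathbb R^n$ be conformal and injective. Then $\nu:=\phi_*(|\phi'|^d\cdot\mu)$ is the $d$-dimensional Minkowski content measure on $\phi(S)$, where $|\phi'|^d\cdot\mu$ is the measure $\mu$ weighted by $|\phi'|^d$, and $\nu$ is the pushforward of $|\phi'|^d\cdot\mu$ under $\phi$.
   Context: A map $\phi:G\to\mathbb R^n$ on an open set $G\subset\mathbb R^n$ is called conformal if it is $C^1$ and its Jacobian matrix at every $x\in G$ is a positive number $s(x)$ times an orthogonal matrix; then $|\phi'(x)|:=s(x)$. (For $n=1$: $\phi$ is $C^1$ with $\phi'\ne0$.) $\lambda^n$ is Lebesgue measure on $\mathbb R^n$. For $S\subset\mathbb R^n$ and $r>0$, $B(S,r)=\{x\in\mathbb R^n:\mathrm{dist}(x,S)\le r\}$ and $\mathrm{Cont}(S;r)=r^{d-n}\lambda^n(B(S,r))$; the $d$-dimensional Minkowski content is $\mathrm{Cont}_d(S)=\lim_{r\to0^+}\mathrm{Cont}(S;r)$ when the limit exists. For $T\subset S\subset\mathbb R^n$, $\partial_ST=S\cap\overline T\cap\overline{S\setminus T}$ is the relative boundary of $T$ in $S$. For $S\in\mathcal M$, a $d$-dimensional Minkowski content measure on $S$ is a Borel measure $\mu$ on $S$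 such that for every compact $K\subset S$: (i) $\mu(K)<\infty$, and (ii) whenever $\mu(\partial_SK)=0$, $\mathrm{Cont}_d(K)$ exists and equals $\mu(K)$. It is unique when it exists. *)

theory Defs
  imports "HOL-Analysis.Analysis"
begin

definition conformal_on :: "(real^'n) set \<Rightarrow> (real^'n \<Rightarrow> real^'n) \<Rightarrow> bool" where
  "conformal_on G \<phi> \<longleftrightarrow>
     (\<forall>x\<in>G. \<phi> differentiable (at x)) \<and>
     continuous_on G (\<lambda>x. jacobian \<phi> (at x)) \<and>
     (\<forall>x\<in>G. \<exists>s>0. \<exists>Q. orthogonal_matrix Q \<and> jacobian \<phi> (at x) = s *\<^sub>R Q)"

text \<open>This is \<open>|\<phi>'(x)|\<close>. The scalar is unique, since \<open>n \<ge> 1\<close>; only points where \<open>\<phi>\<close> is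
  conformal matter.\<close>

definition conformal_factor :: "(real^'n \<Rightarrow> real^'n) \<Rightarrow> real^'n \<Rightarrow> real" where
  "conformal_factor \<phi> x =
     (THE s. s > 0 \<and> (\<exists>Q. orthogonal_matrix Q \<and> jacobian \<phi> (at x) = s *\<^sub>R Q))"

definition locally_closed_sets :: "(real^'n) set set" where
  "locally_closed_sets = {U \<inter> C | U C. open U \<and> closed C}"

text \<open>The library sets \<open>infdist x {} = 0\<close>, whereas a point has infinite distance from the
  empty set; hence the extra condition, which makes the parallel set of \<open>{}\<close> empty.\<close>

definition parallel_set :: "(real^'n) set \<Rightarrow> real \<Rightarrow> (real^'n) set" where
  "parallel_set S r = {x. S \<noteq> {} \<and> infdist x S \<le> r}"

definition cont_at :: "real \<Rightarrow> (real^'n) set \<Rightarrow> real \<Rightarrow> ennreal" where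
  "cont_at d S r =
     ennreal (r powr (d - real CARD('n))) * emeasure lebesgue (parallel_set S r)"

definition has_minkowski_content :: "real \<Rightarrow> (real^'n) set \<Rightarrow> ennreal \<Rightarrow> bool" where
  "has_minkowski_content d S c \<longleftrightarrow> (cont_at d S \<longlongrightarrow> c) (at_right 0)"

definition rel_boundary :: "(real^'n) set \<Rightarrow> (real^'n) set \<Rightarrow> (real^'n) set" where
  "rel_boundary S T = S \<inter> closure T \<inter> closure (S - T)"

text \<open>The notion is only defined for locally closed \<open>S\<close>, so this is part of the predicate.
  A Borel measure on \<open>S\<close> is a measure with underlying space \<open>S\<close> and the trace of the Borel
  sigma-algebra.\<close>

definition minkowski_content_measure ::
    "real \<Rightarrow> (real^'n) set \<Rightarrow> (real^'n) measure \<Rightarrow> bool" where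
  "minkowski_content_measure d S \<mu> \<longleftrightarrow>
     S \<in> locally_closed_sets \<and>
     sets \<mu> = sets (restrict_space borel S) \<and>
     (\<forall>K. compact K \<and> K \<subseteq> S \<longrightarrow>
        emeasure \<mu> K < \<infinity> \<and>
        (emeasure \<mu> (rel_boundary S K) = 0 \<longrightarrow> has_minkowski_content d K (emeasure \<mu> K)))"

end

theory Submission
  imports Defs
begin

text \<open>
  A conformal map is, near each point \<open>x\<close> and at small scales, almost a similarity with ratio
  \<open>s x = \<bar>\<phi>'(x)\<bar>\<close>. A similarity of ratio \<open>s\<close> multiplies volumes by \<open>s^n\<close> and turns distance \<open>r\<close> into
  \<open>s r\<close>, hence multiplies the content \<open>r powr (d - n) * \<lambda>(B(T, r))\<close> at small scales by
  \<open>s^n * s powr (d - n) = s powr d\<close>. Cutting \<open>S\<close> into pieces on which \<open>s\<close> is nearly constant and adding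
  up gives the weight \<open>s powr d\<close>.

  Three points carry the argument.

  Volume: a map which is Lipschitz with constant \<open>M\<close> near each point of a set multiplies its
  volume by at most \<open>M^n\<close> (\<open>emeasure_lebesgue_pointwise_Lipschitz_image_le\<close>). Applied to \<open>\<phi>\<close> and to its
  inverse this bounds volumes on both sides, and the factor \<open>q\<close> by which \<open>\<phi>\<close> fails to be a
  similarity on a compact set may be taken as close to 1 as desired (\<open>near_similarity\<close>). The result
  is \<open>cont_at_image_le\<close> and \<open>cont_at_image_ge\<close>, for a compact piece on which \<open>s\<close> varies by at most
  the factor \<open>q\<close>.

  Pieces: the pieces of a compact \<open>L \<subseteq> S\<close> are cut out by the level sets \<open>s = t * q^i\<close>. Slicing adds to
  the relative boundary only the levels themselves (\<open>rel_boundary_slice\<close>), of which only countably many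
  have positive measure, so \<open>t\<close> can be chosen to make all pieces have null boundary
  (\<open>null_geometric_levels\<close>). The hypothesis on \<open>\<mu>\<close> then gives the content of every piece.

  Adding up: content is subadditive, but for a lower bound the overlap of the parallel sets of
  two adjacent pieces, which touch along a level, must be negligible. In \<open>S\<close> it is, because
  the contents of the pieces and of their union exist and are additive (\<open>cont_overlap_tendsto_0\<close>);
  and \<open>\<phi>\<close> distorts the overlap by a bounded factor only (\<open>cont_overlap_image_tendsto_0\<close>).

  Letting \<open>q\<close> tend to 1 yields the content of \<open>\<phi> ` L\<close> (\<open>has_content_image\<close>). Finally \<open>\<phi>\<close> maps relative
  boundaries into relative boundaries, and \<open>s powr d > 0\<close>, so a compact subset of \<open>\<phi> ` S\<close> with null
  boundary for the image measure is the image of one with null boundary for \<open>\<mu>\<close>.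
\<close>

section \<open>Volume of pointwise Lipschitz images\<close>

text \<open>The constant is sharp because a Lipschitz condition for the Euclidean norm maps a ball into a
  ball: by Vitali, almost all of \<open>E\<close> is covered by disjoint balls centred in \<open>E\<close> whose total volume
  is at most that of \<open>E\<close> plus any prescribed error; the images of their intersections with \<open>E\<close>
  lie in balls of \<open>M\<close> times the radius. The uncovered null set has a null image since \<open>f\<close> is locally
  Lipschitz on \<open>E\<close>.\<close>

lemma emeasure_lebesgue_pointwise_Lipschitz_image_le:
  fixes f :: "'a::euclidean_space \<Rightarrow> 'a"
  assumes E: "E \<in> sets lebesgue" and fE: "f ` E \<in> sets lebesgue" and M: "M > 0"
    and lip: "\<And>x. x \<in> E \<Longrightarrow> \<exists>\<delta>>0. \<forall>y\<in>E. dist x y < \<delta> \<longrightarrow> dist (f x) (f y) \<le> M * dist x y"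
  shows "emeasure lebesgue (f ` E) \<le> ennreal (M ^ DIM('a)) * emeasure lebesgue E"
proof (rule ennreal_le_epsilon)
  fix e :: real assume e: "0 < e"
  let ?n = "DIM('a)"
  define e' where "e' = e / M ^ ?n"
  have e': "e' > 0" and M_e': "M ^ ?n * e' = e"
    using e M by (simp_all add: e'_def)
  obtain U where U: "open U" "E \<subseteq> U" "U - E \<in> lmeasurable"
    and U_small: "emeasure lebesgue (U - E) < ennreal e'"
    using sets_lebesgue_outer_open[OF E e'] .
  have [measurable]: "U \<in> sets lebesgue"
    using U(1) by (simp add: borel_open)
  have emU: "emeasure lebesgue U \<le> emeasure lebesgue E + ennreal e'"
  proof -
    have "emeasure lebesgue U = emeasure lebesgue (E \<union> (U - E))"
      using U by (simp add: Un_absorb1)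
    also have "\<dots> \<le> emeasure lebesgue E + emeasure lebesgue (U - E)"
      using E U by (intro emeasure_subadditive) auto
    finally show ?thesis
      using U_small by (meson add_left_mono less_imp_le order_trans)
  qed
  define K where "K = {(x, r). x \<in> E \<and> 0 < r \<and> ball x r \<subseteq> U \<and>
    (\<forall>y\<in>E. dist x y < r \<longrightarrow> dist (f x) (f y) \<le> M * dist x y)}"
  have vitali: "\<exists>i. i \<in> K \<and> x \<in> ball (fst i) (snd i) \<and> snd i < d" if x: "x \<in> E" and d: "0 < d" for x d
  proof -
    obtain \<delta> where "\<delta> > 0" and \<delta>: "\<forall>y\<in>E. dist x y < \<delta> \<longrightarrow> dist (f x) (f y) \<le> M * dist x y"
      using lip[OF x] by blast
    obtain \<rho> where "\<rho> > 0" and \<rho>: "ball x \<rho> \<subseteq> U"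
      using U x open_contains_ball by blast
    define r where "r = min (min \<delta> \<rho>) (d / 2)"
    have "(x, r) \<in> K"
      using x \<open>\<delta> > 0\<close> \<open>\<rho> > 0\<close> d \<delta> \<rho> by (auto simp: K_def r_def)
    moreover have "r > 0" "r < d"
      using \<open>\<delta> > 0\<close> \<open>\<rho> > 0\<close> d by (auto simp: r_def)
    ultimately show ?thesis
      by (intro exI[of _ "(x, r)"]) auto
  qed
  obtain C where C: "countable C" "C \<subseteq> K"
    and disj: "pairwise (\<lambda>i j. disjnt (ball (fst i) (snd i)) (ball (fst j) (snd j))) C"
    and neg: "negligible (E - (\<Union>i\<in>C. ball (fst i) (snd i)))"
    using Vitali_covering_theorem_balls[of E K fst snd, OF vitali] by blast
  \<comment> \<open>Enumerate the balls by the naturals, with radius 0, that is the empty ball, at unused indices.\<close>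
  define J where "J = to_nat_on C ` C"
  define c where "c k = fst (from_nat_into C k)" for k
  define r where "r k = (if k \<in> J then snd (from_nat_into C k) else 0)" for k
  have J: "from_nat_into C k \<in> C" if "k \<in> J" for k
    using that C(1) by (auto simp: J_def)
  have in_K: "(c k, r k) \<in> K" if "k \<in> J" for k
    using J[OF that] C(2) that by (auto simp: c_def r_def)
  have r_nonneg: "r k \<ge> 0" for k
    using in_K[of k] by (cases "k \<in> J") (auto simp: K_def r_def)
  have balls: "(\<Union>i\<in>C. ball (fst i) (snd i)) = (\<Union>k. ball (c k) (r k))"
  proof
    show "(\<Union>i\<in>C. ball (fst i) (snd i)) \<subseteq> (\<Union>k. ball (c k) (r k))"
    proof (rule UN_least)
      fix i assume "i \<in> C"
      then have "from_nat_into C (to_nat_on C i) = i" "to_nat_on C i \<in> J"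
        using C(1) by (auto simp: J_def)
      then have "ball (c (to_nat_on C i)) (r (to_nat_on C i)) = ball (fst i) (snd i)"
        by (simp add: c_def r_def)
      then show "ball (fst i) (snd i) \<subseteq> (\<Union>k. ball (c k) (r k))"
        by blast
    qed
    show "(\<Union>k. ball (c k) (r k)) \<subseteq> (\<Union>i\<in>C. ball (fst i) (snd i))"
    proof (rule UN_least)
      fix k show "ball (c k) (r k) \<subseteq> (\<Union>i\<in>C. ball (fst i) (snd i))"
      proof (cases "k \<in> J")
        case True
        then have "ball (c k) (r k) = ball (fst (from_nat_into C k)) (snd (from_nat_into C k))"
          by (simp add: c_def r_def)
        with J[OF True] show ?thesis by blast
      qed (simp add: r_def)
    qed
  qed
  have disj_nat: "disjoint_family (\<lambda>k. ball (c k) (r k))"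
    unfolding disjoint_family_on_def
  proof (intro ballI impI)
    fix k l :: nat assume "k \<noteq> l"
    show "ball (c k) (r k) \<inter> ball (c l) (r l) = {}"
    proof (cases "k \<in> J \<and> l \<in> J")
      case True
      then have "from_nat_into C k \<noteq> from_nat_into C l"
        using \<open>k \<noteq> l\<close> C(1) by (auto simp: J_def)
      with True J disj show ?thesis
        by (auto simp: pairwise_def disjnt_def c_def r_def)
    qed (auto simp: r_def)
  qed
  let ?N = "E - (\<Union>k. ball (c k) (r k))"
  have negN: "negligible (f ` ?N)"
  proof (rule negligible_locally_Lipschitz_image)
    show "negligible ?N" using neg by (simp add: balls)
    fix x assume "x \<in> ?N"
    then obtain \<delta> where "\<delta> > 0" "\<forall>y\<in>E. dist x y < \<delta> \<longrightarrow> dist (f x) (f y) \<le> M * dist x y"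
      using lip by blast
    then show "\<exists>T B. open T \<and> x \<in> T \<and> (\<forall>y\<in>?N \<inter> T. norm (f y - f x) \<le> B * norm (y - x))"
      by (intro exI[of _ "ball x \<delta>"] exI[of _ M]) (auto simp: dist_norm norm_minus_commute)
  qed simp
  have cover: "f ` E \<subseteq> f ` ?N \<union> (\<Union>k. cball (f (c k)) (M * r k))"
  proof
    fix w assume "w \<in> f ` E"
    then obtain y where y: "y \<in> E" "w = f y" by blast
    show "w \<in> f ` ?N \<union> (\<Union>k. cball (f (c k)) (M * r k))"
    proof (cases "y \<in> ?N")
      case False
      then obtain k where k: "dist (c k) y < r k" using y by auto
      then have "k \<in> J" by (cases "k \<in> J") (auto simp: r_def)
      then have "dist (f (c k)) w \<le> M * dist (c k) y"
        using in_K y k by (auto simp: K_def)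
      also have "\<dots> \<le> M * r k" using k M by simp
      finally show ?thesis by auto
    qed (use y in auto)
  qed
  have null: "f ` ?N \<in> null_sets lebesgue"
    using negN by (simp add: negligible_iff_null_sets)
  have "emeasure lebesgue (f ` E) \<le> emeasure lebesgue (f ` ?N \<union> (\<Union>k. cball (f (c k)) (M * r k)))"
    using null by (intro emeasure_mono cover) auto
  also have "\<dots> = emeasure lebesgue (\<Union>k. cball (f (c k)) (M * r k))"
    by (subst Un_commute) (rule emeasure_Un_null_set[OF _ null], auto)
  also have "\<dots> \<le> (\<Sum>k. emeasure lebesgue (cball (f (c k)) (M * r k)))"
    by (rule emeasure_subadditive_countably) auto
  also have "\<dots> = (\<Sum>k. ennreal (M ^ ?n) * emeasure lebesgue (ball (c k) (r k)))"
  proof (rule suminf_cong)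
    fix k
    have "emeasure lebesgue (cball (f (c k)) (M * r k)) = ennreal (unit_ball_vol ?n * (M * r k) ^ ?n)"
      using M r_nonneg[of k] by (simp add: emeasure_cball)
    also have "\<dots> = ennreal (M ^ ?n * (unit_ball_vol ?n * r k ^ ?n))"
      by (simp add: power_mult_distrib mult_ac)
    also have "\<dots> = ennreal (M ^ ?n) * emeasure lebesgue (ball (c k) (r k))"
      using M r_nonneg[of k] by (simp add: emeasure_ball ennreal_mult)
    finally show "emeasure lebesgue (cball (f (c k)) (M * r k)) =
      ennreal (M ^ ?n) * emeasure lebesgue (ball (c k) (r k))" .
  qed
  also have "\<dots> = ennreal (M ^ ?n) * (\<Sum>k. emeasure lebesgue (ball (c k) (r k)))"
    by (rule ennreal_suminf_cmult)
  also have "(\<Sum>k. emeasure lebesgue (ball (c k) (r k))) = emeasure lebesgue (\<Union>k. ball (c k) (r k))"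
    using disj_nat by (intro suminf_emeasure) auto
  also have "\<dots> \<le> emeasure lebesgue U"
  proof (intro emeasure_mono UN_least)
    fix k show "ball (c k) (r k) \<subseteq> U"
      using in_K[of k] by (cases "k \<in> J") (auto simp: K_def r_def)
  qed simp
  also have "\<dots> \<le> emeasure lebesgue E + ennreal e'" by (rule emU)
  finally have "emeasure lebesgue (f ` E) \<le> ennreal (M ^ ?n) * (emeasure lebesgue E + ennreal e')"
    by (simp add: mult_left_mono)
  also have "\<dots> = ennreal (M ^ ?n) * emeasure lebesgue E + ennreal e"
    using M e' by (simp add: distrib_left ennreal_mult[symmetric] M_e')
  finally show "emeasure lebesgue (f ` E) \<le> ennreal (M ^ ?n) * emeasure lebesgue E + ennreal e" .
qed

section \<open>Parallel sets of compact sets\<close>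

lemma parallel_set_compact_iff:
  assumes "compact T"
  shows "y \<in> parallel_set T r \<longleftrightarrow> (\<exists>x\<in>T. dist x y \<le> r)"
proof
  assume "y \<in> parallel_set T r"
  then have "T \<noteq> {}" "infdist y T \<le> r" by (auto simp: parallel_set_def)
  then show "\<exists>x\<in>T. dist x y \<le> r"
    using infdist_attains_inf[of T y] compact_imp_closed[OF assms] by (metis dist_commute)
next
  assume "\<exists>x\<in>T. dist x y \<le> r"
  then show "y \<in> parallel_set T r"
    unfolding parallel_set_def by (auto simp: dist_commute intro: infdist_le2)
qed

lemma compact_parallel_set:
  assumes "compact T"
  shows "compact (parallel_set T r)"
proof (cases "T = {}")
  case False
  then have "parallel_set T r = {x. infdist x T \<le> r}" by (simp add: parallel_set_def)
  with compact_infdist_le[OF False assms] show ?thesis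
  proof (cases "r > 0")
    case False
    have "closed {x. infdist x T \<le> r}"
      by (intro closed_Collect_le continuous_intros)
    moreover have "{x. infdist x T \<le> r} \<subseteq> {x. infdist x T \<le> 1}" using False by auto
    ultimately show ?thesis
      using compact_infdist_le[OF \<open>T \<noteq> {}\<close> assms, of 1] \<open>parallel_set T r = _\<close>
      by (metis bounded_subset compact_eq_bounded_closed zero_less_one)
  qed simp
qed (simp add: parallel_set_def)

lemma compact_in_sets_lebesgue: "compact A \<Longrightarrow> A \<in> sets lebesgue"
  for A :: "'a::euclidean_space set"
  by (simp add: borel_compact)

lemma emeasure_lebesgue_compact_finite: "compact A \<Longrightarrow> emeasure lebesgue A < \<infinity>"
  for A :: "'a::euclidean_space set"
  using lmeasurable_compact fmeasurableD2 by (metis infinity_ennreal_def less_top)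

text \<open>The defect of additivity of the content at scale \<open>r\<close>. It is the quantity that has to vanish
  in the limit for the content to be additive on \<open>A\<close> and \<open>B\<close>.\<close>

definition cont_overlap :: "real \<Rightarrow> (real^'n) set \<Rightarrow> (real^'n) set \<Rightarrow> real \<Rightarrow> ennreal" where
  "cont_overlap d A B r =
     ennreal (r powr (d - real CARD('n))) * emeasure lebesgue (parallel_set A r \<inter> parallel_set B r)"

lemma cont_at_finite: "compact T \<Longrightarrow> cont_at d T r < \<infinity>"
  unfolding cont_at_def
  using emeasure_lebesgue_compact_finite[OF compact_parallel_set]
  by (auto simp: ennreal_mult_less_top)

lemma cont_at_add_eq:
  assumes "compact A" "compact B"
  shows "cont_at d A r + cont_at d B r = cont_at d (A \<union> B) r + cont_overlap d A B r"
proof -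
  have "parallel_set (A \<union> B) r = parallel_set A r \<union> parallel_set B r"
    using assms by (auto simp: parallel_set_compact_iff compact_Un)
  moreover have "parallel_set A r \<in> sets lebesgue" "parallel_set B r \<in> sets lebesgue"
    using assms by (auto intro!: compact_in_sets_lebesgue compact_parallel_set)
  ultimately show ?thesis
    unfolding cont_at_def cont_overlap_def
    by (metis distrib_left emeasure_Un_Int)
qed

lemma tendsto_at_right_0_scale:
  fixes k :: real
  assumes "(f \<longlongrightarrow> c) (at_right 0)" "k > 0"
  shows "((\<lambda>r. f (k * r)) \<longlongrightarrow> c) (at_right 0)"
proof -
  have "filterlim (\<lambda>r. k * r) (at_right 0) (at_right 0)"
    using assms(2) filterlim_times_pos[of "\<lambda>r. r" 0 "at_right 0" k 0]
    by (simp add: filterlim_ident)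
  from filterlim_compose[OF assms(1) this] show ?thesis .
qed

text \<open>When the content at scale \<open>r\<close> converges on \<open>A\<close>, on \<open>B\<close> and on \<open>A \<union> B\<close> to values which add up,
  the two parallel sets are asymptotically disjoint, even though \<open>A\<close> and \<open>B\<close> may meet.\<close>

lemma cont_overlap_tendsto_0:
  assumes "compact A" "compact B"
    and "has_minkowski_content d A a" "has_minkowski_content d B b"
    and "has_minkowski_content d (A \<union> B) (a + b)"
    and "a < \<infinity>" "b < \<infinity>"
  shows "(cont_overlap d A B \<longlongrightarrow> 0) (at_right 0)"
proof -
  have "((\<lambda>r. (cont_at d A r + cont_at d B r) - cont_at d (A \<union> B) r) \<longlongrightarrow> (a + b) - (a + b)) (at_right 0)"
    using assms by (intro tendsto_diff_ennreal tendsto_add) (auto simp: has_minkowski_content_def)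
  moreover have "(cont_at d A r + cont_at d B r) - cont_at d (A \<union> B) r = cont_overlap d A B r" for r
    using cont_at_add_eq[OF assms(1,2), of d r] cont_at_finite[of "A \<union> B" d r] assms(1,2)
    by (simp add: compact_Un)
  ultimately show ?thesis
    using assms(6,7) by (simp add: less_top)
qed

section \<open>Conformal embeddings are nearly similarities at small scales\<close>

lemma eventually_at_right_0_scale:
  fixes k :: real
  assumes "eventually P (at_right 0)" "k > 0"
  shows "eventually (\<lambda>r. P (k * r)) (at_right 0)"
  using filterlim_times_pos[of "\<lambda>r. r" 0 "at_right 0" k 0] assms
  by (auto simp: filterlim_ident filterlim_iff)

lemma eventually_at_right_0_le:
  fixes a :: real
  assumes "a > 0"
  shows "\<forall>\<^sub>F r in at_right 0. 0 < r \<and> r \<le> a"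
  using eventually_at_right_less[of 0] eventually_at_right_real[OF assms]
  by eventually_elim auto

locale conformal_embedding =
  fixes G :: "(real^'n) set" and \<phi> :: "real^'n \<Rightarrow> real^'n"
  assumes open_G: "open G" and conformal: "conformal_on G \<phi>" and inj: "inj_on \<phi> G"
begin

abbreviation s :: "real^'n \<Rightarrow> real" where "s \<equiv> conformal_factor \<phi>"

abbreviation J :: "real^'n \<Rightarrow> real^'n^'n" where "J x \<equiv> jacobian \<phi> (at x)"

abbreviation g :: "real^'n \<Rightarrow> real^'n" where "g \<equiv> inv_into G \<phi>"

lemma has_derivative_J: "x \<in> G \<Longrightarrow> (\<phi> has_derivative (\<lambda>h. J x *v h)) (at x)"
  using conformal by (simp add: conformal_on_def jacobian_works)

lemma
  assumes "x \<in> G"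
  shows s_pos: "s x > 0" and norm_J: "norm (J x *v v) = s x * norm v"
proof -
  obtain a Q where a: "a > 0" "orthogonal_matrix Q" "J x = a *\<^sub>R Q"
    using conformal assms by (auto simp: conformal_on_def)
  have similarity: "norm (J x *v v) = b * norm v"
    if "b > 0" "orthogonal_matrix R" "J x = b *\<^sub>R R" for b R v
  proof -
    have "orthogonal_transformation ((*v) R)"
      using that by (simp add: orthogonal_transformation_matrix)
    then have "norm (R *v v) = norm v"
      by (simp add: orthogonal_transformation_norm)
    with that show ?thesis
      by (simp add: scaleR_matrix_vector_assoc[symmetric])
  qed
  have "s x = a"
    unfolding conformal_factor_def
  proof (rule the_equality)
    show "a > 0 \<and> (\<exists>Q. orthogonal_matrix Q \<and> J x = a *\<^sub>R Q)" using a by blast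
    fix b assume "b > 0 \<and> (\<exists>Q. orthogonal_matrix Q \<and> J x = b *\<^sub>R Q)"
    then obtain R where "b > 0" "orthogonal_matrix R" "J x = b *\<^sub>R R" by blast
    then show "b = a"
      using similarity[of b R "axis undefined 1"] similarity[OF a, of "axis undefined 1"] by simp
  qed
  then show "s x > 0" "norm (J x *v v) = s x * norm v"
    using a similarity by auto
qed

lemma continuous_on_J: "continuous_on G J"
  using conformal by (simp add: conformal_on_def)

lemma continuous_on_s: "continuous_on G s"
proof -
  have "continuous_on G (\<lambda>x. norm (column undefined (J x)))"
    unfolding column_def
    by (intro continuous_on_norm continuous_on_vec_lambda continuous_on_component continuous_on_J)
  moreover have "norm (column undefined (J x)) = s x" if "x \<in> G" for x
    using norm_J[OF that, of "axis undefined 1"] by (simp add: matrix_vector_mult_basis)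
  ultimately show ?thesis
    by (simp cong: continuous_on_cong)
qed

lemma continuous_on_\<phi>: "continuous_on G \<phi>"
  using conformal
  by (auto simp: conformal_on_def intro!: continuous_at_imp_continuous_on differentiable_imp_continuous_within)

lemma g_\<phi> [simp]: "x \<in> G \<Longrightarrow> g (\<phi> x) = x"
  using inj by simp

lemma open_image_G: "open (\<phi> ` G)"
  using continuous_on_\<phi> open_G inj by (rule invariance_of_domain)

lemma continuous_on_g: "continuous_on (\<phi> ` G) g"
  by (rule continuous_on_inverse_open[OF open_G continuous_on_\<phi>]) auto

lemma compact_image: "compact T \<Longrightarrow> T \<subseteq> G \<Longrightarrow> compact (\<phi> ` T)"
  using continuous_on_\<phi> compact_continuous_image continuous_on_subset by blast

lemma s_bounds:
  assumes "compact L" "L \<subseteq> G"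
  obtains u v where "0 < u" "0 < v" "\<And>x. x \<in> L \<Longrightarrow> u \<le> s x \<and> s x \<le> v"
proof (cases "L = {}")
  case False
  have "continuous_on L s" using continuous_on_s assms(2) continuous_on_subset by blast
  then obtain a b where "a \<in> L" "b \<in> L" "\<And>x. x \<in> L \<Longrightarrow> s a \<le> s x" "\<And>x. x \<in> L \<Longrightarrow> s x \<le> s b"
    using continuous_attains_inf[OF assms(1) False] continuous_attains_sup[OF assms(1) False]
    by metis
  with s_pos assms(2) show ?thesis by (intro that[of "s a" "s b"]) auto
qed (use that[of 1 1] in auto)

text \<open>This is where continuous differentiability enters. If the Jacobian varies by at most \<open>\<epsilon>\<close> in
  operator norm over a ball around \<open>x\<close>, then \<open>\<phi>\<close> differs there from its linearization at \<open>x\<close> by at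
  most \<open>\<epsilon>\<close> times the distance to \<open>x\<close>, while the linearization stretches by exactly \<open>s x\<close>, which is
  bounded away from zero on \<open>L\<close>.\<close>

lemma near_similarity:
  assumes L: "compact L" "L \<subseteq> G" and c: "c > 1"
  obtains \<delta> where "\<delta> > 0"
    "\<And>x y. x \<in> L \<Longrightarrow> dist x y \<le> \<delta> \<Longrightarrow>
       y \<in> G \<and> s y \<le> c * s x \<and> s x \<le> c * s y \<and>
       dist (\<phi> x) (\<phi> y) \<le> c * s x * dist x y \<and> s x * dist x y \<le> c * dist (\<phi> x) (\<phi> y)"
proof -
  obtain m v where m: "m > 0" and mv: "\<And>x. x \<in> L \<Longrightarrow> m \<le> s x \<and> s x \<le> v"
    using s_bounds[OF L] by blast
  define \<epsilon> where "\<epsilon> = m * (c - 1) / c"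
  let ?k = "real CARD('n) * real CARD('n)"
  have \<epsilon>: "\<epsilon> > 0" "c * \<epsilon> = m * (c - 1)" using m c by (auto simp: \<epsilon>_def)
  have "\<epsilon> \<le> c * \<epsilon>" using mult_right_mono[of 1 c \<epsilon>] \<epsilon>(1) c by linarith
  obtain \<delta>1 where \<delta>1: "\<delta>1 > 0" "(\<Union>x\<in>L. cball x \<delta>1) \<subseteq> G"
    using compact_subset_open_imp_cball_epsilon_subset[OF L(1) open_G L(2)] by blast
  define N where "N = parallel_set L \<delta>1"
  have N: "compact N" "N \<subseteq> G"
    using compact_parallel_set[OF L(1)] \<delta>1 by (auto simp: N_def parallel_set_compact_iff L)
  have "uniformly_continuous_on N J"
  proof (rule compact_uniformly_continuous)
    show "continuous_on N J"
      using continuous_on_J N(2) by (rule continuous_on_subset)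
  qed (rule N)
  moreover have "\<epsilon> / ?k > 0" using \<epsilon> by simp
  ultimately obtain \<delta>2 where \<delta>2: "\<delta>2 > 0"
    "\<And>x y. x \<in> N \<Longrightarrow> y \<in> N \<Longrightarrow> dist y x < \<delta>2 \<Longrightarrow> dist (J y) (J x) < \<epsilon> / ?k"
    by (rule uniformly_continuous_onE) blast
  define \<delta> where "\<delta> = min \<delta>1 (\<delta>2 / 2)"
  show ?thesis
  proof
    show "\<delta> > 0" using \<delta>1 \<delta>2 by (simp add: \<delta>_def)
    fix x y assume x: "x \<in> L" and xy: "dist x y \<le> \<delta>"
    let ?S = "cball x \<delta>"
    have "\<delta> \<le> \<delta>1" by (simp add: \<delta>_def)
    then have S: "?S \<subseteq> N" using x L(1) by (force simp: N_def parallel_set_compact_iff)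
    have "y \<in> ?S" using xy by simp
    with S N(2) have y: "y \<in> G" by blast
    have xG: "x \<in> G" using x L(2) by blast
    have J_close: "onorm ((*v) (J z - J x)) \<le> \<epsilon>" if z: "z \<in> ?S" for z
    proof -
      have "x \<in> N" "z \<in> N" using S z \<open>\<delta> > 0\<close> by auto
      moreover have "dist z x < \<delta>2" using z \<delta>2(1) by (simp add: \<delta>_def dist_commute)
      ultimately have "dist (J z) (J x) < \<epsilon> / ?k" by (rule \<delta>2(2))
      then have norm_le: "norm (J z - J x) \<le> \<epsilon> / ?k" by (simp add: dist_norm)
      have "\<bar>(J z - J x) $ i $ j\<bar> \<le> \<epsilon> / ?k" for i j
      proof -
        have "\<bar>(J z - J x) $ i $ j\<bar> \<le> norm ((J z - J x) $ i)"
          by (rule component_le_norm_cart)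
        also have "\<dots> \<le> norm (J z - J x)"
          by (rule Finite_Cartesian_Product.norm_nth_le)
        finally show ?thesis using norm_le by linarith
      qed
      then have "onorm ((*v) (J z - J x)) \<le> ?k * (\<epsilon> / ?k)"
        by (rule onorm_le_matrix_component)
      then show ?thesis by simp
    qed
    have J_diff: "norm ((J y - J x) *v h) \<le> \<epsilon> * norm h" for h
    proof -
      have "norm ((J y - J x) *v h) \<le> onorm ((*v) (J y - J x)) * norm h"
        by (intro onorm matrix_vector_mul_bounded_linear)
      also have "\<dots> \<le> \<epsilon> * norm h" using xy by (intro mult_right_mono J_close) auto
      finally show ?thesis .
    qed
    have s_diff: "\<bar>s y - s x\<bar> \<le> \<epsilon>"
    proof -
      let ?e = "axis undefined 1 :: real^'n"
      have "\<bar>s y - s x\<bar> = \<bar>norm (J y *v ?e) - norm (J x *v ?e)\<bar>"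
        by (simp add: norm_J y xG)
      also have "\<dots> \<le> norm ((J y - J x) *v ?e)"
        by (simp add: matrix_vector_mult_diff_rdistrib norm_triangle_ineq3)
      also have "\<dots> \<le> \<epsilon>" using J_diff[of ?e] by simp
      finally show ?thesis .
    qed
    have lin: "norm (\<phi> y - \<phi> x - J x *v (y - x)) \<le> norm (y - x) * \<epsilon>"
    proof (rule differentiable_bound_linearization[where S = ?S and f' = "\<lambda>z. (*v) (J z)"])
      fix t :: real assume t: "t \<in> {0..1}"
      have "dist x (x + t *\<^sub>R (y - x)) = t * dist x y"
        using t by (simp add: dist_norm norm_minus_commute)
      also have "\<dots> \<le> 1 * dist x y" using t by (intro mult_right_mono) auto
      finally show "x + t *\<^sub>R (y - x) \<in> ?S" using xy by simp
    next
      fix z assume z: "z \<in> ?S"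
      show "(\<phi> has_derivative (\<lambda>h. J z *v h)) (at z within ?S)"
        by (rule has_derivative_at_withinI, rule has_derivative_J) (use S N(2) z in blast)
      have "(*v) (J z) - (*v) (J x) = (*v) (J z - J x)"
        by (rule ext) (simp only: matrix_vector_mult_diff_rdistrib minus_apply)
      then show "onorm ((*v) (J z) - (*v) (J x)) \<le> \<epsilon>"
        using J_close[OF z] by (simp only:)
    qed (use \<open>\<delta> > 0\<close> in simp)
    have "\<bar>norm (\<phi> y - \<phi> x) - norm (J x *v (y - x))\<bar> \<le> norm (\<phi> y - \<phi> x - J x *v (y - x))"
      by (rule norm_triangle_ineq3)
    with lin have "\<bar>norm (\<phi> y - \<phi> x) - norm (J x *v (y - x))\<bar> \<le> norm (y - x) * \<epsilon>"
      by linarith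
    moreover have "norm (\<phi> y - \<phi> x) = dist (\<phi> x) (\<phi> y)" "norm (y - x) = dist x y"
      by (metis dist_commute dist_norm)+
    ultimately have dist_diff: "\<bar>dist (\<phi> x) (\<phi> y) - s x * dist x y\<bar> \<le> \<epsilon> * dist x y"
      by (simp only: norm_J[OF xG] mult.commute[of \<epsilon>])
    have "m \<le> s x" using mv x by blast
    then have cs: "c * \<epsilon> \<le> (c - 1) * s x"
      using mult_left_mono[of m "s x" "c - 1"] \<epsilon>(2) c by (simp add: mult.commute)
    have "s y \<le> c * s x" "s x \<le> c * s y"
    proof -
      have "s y \<le> s x + c * \<epsilon>" using s_diff \<open>\<epsilon> \<le> c * \<epsilon>\<close> by linarith
      also have "\<dots> \<le> c * s x" using cs by (simp add: algebra_simps)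
      finally show "s y \<le> c * s x" .
      have "c * (s x - \<epsilon>) \<le> c * s y" using s_diff c by (intro mult_left_mono) auto
      then show "s x \<le> c * s y" using cs by (simp add: algebra_simps)
    qed
    moreover have "dist (\<phi> x) (\<phi> y) \<le> c * s x * dist x y"
    proof -
      have "dist (\<phi> x) (\<phi> y) \<le> (s x + \<epsilon>) * dist x y"
        using dist_diff by (simp add: algebra_simps)
      also have "\<dots> \<le> c * s x * dist x y"
        using cs \<open>\<epsilon> \<le> c * \<epsilon>\<close> by (intro mult_right_mono) (auto simp: algebra_simps)
      finally show ?thesis .
    qed
    moreover have "s x * dist x y \<le> c * dist (\<phi> x) (\<phi> y)"
    proof -
      have "s x * dist x y \<le> c * (s x - \<epsilon>) * dist x y"
        using cs by (intro mult_right_mono) (auto simp: algebra_simps)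
      also have "\<dots> = c * ((s x - \<epsilon>) * dist x y)" by simp
      also have "\<dots> \<le> c * dist (\<phi> x) (\<phi> y)"
        using dist_diff c by (intro mult_left_mono) (auto simp: algebra_simps)
      finally show ?thesis .
    qed
    ultimately show "y \<in> G \<and> s y \<le> c * s x \<and> s x \<le> c * s y \<and>
       dist (\<phi> x) (\<phi> y) \<le> c * s x * dist x y \<and> s x * dist x y \<le> c * dist (\<phi> x) (\<phi> y)"
      using y by blast
  qed
qed

lemma near_similarity_at:
  assumes "x \<in> G" "c > 1"
  obtains \<delta> where "\<delta> > 0"
    "\<And>y. dist x y \<le> \<delta> \<Longrightarrow>
       dist (\<phi> x) (\<phi> y) \<le> c * s x * dist x y \<and> s x * dist x y \<le> c * dist (\<phi> x) (\<phi> y)"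
proof (rule near_similarity[of "{x}" c])
  fix \<delta> assume "\<delta> > 0" "\<And>x' y. x' \<in> {x} \<Longrightarrow> dist x' y \<le> \<delta> \<Longrightarrow>
       y \<in> G \<and> s y \<le> c * s x' \<and> s x' \<le> c * s y \<and>
       dist (\<phi> x') (\<phi> y) \<le> c * s x' * dist x' y \<and> s x' * dist x' y \<le> c * dist (\<phi> x') (\<phi> y)"
  then show thesis by (intro that[of \<delta>]) blast+
qed (use assms in auto)

lemma emeasure_image_le:
  assumes E: "compact E" "E \<subseteq> G" and M: "M > 0" "\<And>x. x \<in> E \<Longrightarrow> s x \<le> M" and c: "c > 1"
  shows "emeasure lebesgue (\<phi> ` E) \<le> ennreal ((c * M) ^ CARD('n)) * emeasure lebesgue E"
proof -
  have "emeasure lebesgue (\<phi> ` E) \<le> ennreal ((c * M) ^ DIM(real^'n)) * emeasure lebesgue E"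
  proof (rule emeasure_lebesgue_pointwise_Lipschitz_image_le)
    show "E \<in> sets lebesgue" "\<phi> ` E \<in> sets lebesgue" "c * M > 0"
      using E M c compact_image compact_in_sets_lebesgue by auto
    fix x assume x: "x \<in> E"
    obtain \<delta> where \<delta>: "\<delta> > 0" "\<And>y. dist x y \<le> \<delta> \<Longrightarrow> dist (\<phi> x) (\<phi> y) \<le> c * s x * dist x y"
      using near_similarity_at[of x c] x E c by (metis subsetD)
    have "c * s x * dist x y \<le> c * M * dist x y" for y
      using M x c by (intro mult_right_mono mult_left_mono) auto
    with \<delta> show "\<exists>\<delta>>0. \<forall>y\<in>E. dist x y < \<delta> \<longrightarrow> dist (\<phi> x) (\<phi> y) \<le> c * M * dist x y"
      by (meson less_imp_le order_trans)
  qed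
  then show ?thesis by simp
qed

text \<open>The inverse map is Lipschitz near each point of the image, with constant at most \<open>c / m\<close>: by
  continuity of the inverse, points near \<open>\<phi> x\<close> come from points near \<open>x\<close>, where \<open>\<phi>\<close> stretches by at
  least \<open>m / c\<close>.\<close>

lemma emeasure_le_image:
  assumes E: "compact E" "E \<subseteq> G" and m: "m > 0" "\<And>x. x \<in> E \<Longrightarrow> m \<le> s x" and c: "c > 1"
  shows "emeasure lebesgue E \<le> ennreal ((c / m) ^ CARD('n)) * emeasure lebesgue (\<phi> ` E)"
proof -
  have gE: "g ` \<phi> ` E = E" using E by (force simp: image_image)
  have "emeasure lebesgue (g ` \<phi> ` E) \<le> ennreal ((c / m) ^ DIM(real^'n)) * emeasure lebesgue (\<phi> ` E)"
  proof (rule emeasure_lebesgue_pointwise_Lipschitz_image_le)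
    show "\<phi> ` E \<in> sets lebesgue" "g ` \<phi> ` E \<in> sets lebesgue" "c / m > 0"
      using E m c compact_image compact_in_sets_lebesgue by (auto simp: gE)
    fix w assume "w \<in> \<phi> ` E"
    then obtain x where x: "x \<in> E" "w = \<phi> x" by blast
    obtain \<delta> where \<delta>: "\<delta> > 0" "\<And>y. dist x y \<le> \<delta> \<Longrightarrow> s x * dist x y \<le> c * dist (\<phi> x) (\<phi> y)"
      using near_similarity_at[of x c] x E c by (metis subsetD)
    obtain \<rho> where \<rho>: "\<rho> > 0" "\<And>z. z \<in> \<phi> ` G \<Longrightarrow> dist z w < \<rho> \<Longrightarrow> dist (g z) (g w) < \<delta>"
      using continuous_on_g \<open>\<delta> > 0\<close> x E unfolding continuous_on_iff by (metis imageI subsetD)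
    show "\<exists>\<delta>>0. \<forall>z\<in>\<phi> ` E. dist w z < \<delta> \<longrightarrow> dist (g w) (g z) \<le> c / m * dist w z"
    proof (intro exI conjI ballI impI)
      fix z assume "z \<in> \<phi> ` E" and wz: "dist w z < \<rho>"
      then obtain y where y: "y \<in> E" "z = \<phi> y" by blast
      have "x \<in> G" "y \<in> G" using x y E by auto
      then have "dist x y \<le> \<delta>"
        using \<rho>(2)[of z] wz x y by (simp add: dist_commute)
      then have "s x * dist x y \<le> c * dist w z" using \<delta> x y by blast
      moreover have "m * dist x y \<le> s x * dist x y" using m x by (intro mult_right_mono) auto
      ultimately show "dist (g w) (g z) \<le> c / m * dist w z"
        using m x y \<open>x \<in> G\<close> \<open>y \<in> G\<close> by (simp add: field_simps)
    qed (rule \<rho>)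
  qed
  then show ?thesis by (simp add: gE)
qed

section \<open>Images of parallel sets\<close>

lemma parallel_set_bounds:
  assumes T: "compact T" "T \<subseteq> G" and c: "c > 1"
    and uv: "\<And>x. x \<in> T \<Longrightarrow> u \<le> s x \<and> s x \<le> v"
  shows "\<forall>\<^sub>F r in at_right 0. \<forall>y\<in>parallel_set T r. y \<in> G \<and> u / c \<le> s y \<and> s y \<le> c * v"
proof -
  obtain \<delta> where \<delta>: "\<delta> > 0" and ns:
    "\<And>x y. x \<in> T \<Longrightarrow> dist x y \<le> \<delta> \<Longrightarrow> y \<in> G \<and> s y \<le> c * s x \<and> s x \<le> c * s y"
    using near_similarity[OF T c] by metis
  show ?thesis
    using eventually_at_right_0_le[OF \<delta>]
  proof eventually_elim
    case (elim r)
    show ?case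
    proof
      fix y assume "y \<in> parallel_set T r"
      then obtain x where x: "x \<in> T" "dist x y \<le> r"
        using T by (auto simp: parallel_set_compact_iff)
      then have y: "y \<in> G" "s y \<le> c * s x" "s x \<le> c * s y" using ns[of x y] elim by auto
      have "s y \<le> c * v" using mult_left_mono[of "s x" v c] uv[OF x(1)] y c by linarith
      moreover have "u \<le> c * s y" using uv x y by force
      ultimately show "y \<in> G \<and> u / c \<le> s y \<and> s y \<le> c * v"
        using y c by (auto simp: field_simps)
    qed
  qed
qed

text \<open>A point at distance at most \<open>r\<close> from \<open>\<phi> x\<close> has a preimage close to \<open>x\<close>, by uniform continuity
  of the inverse near the compact set \<open>\<phi> ` T\<close>; only then does the near similarity bound the distance
  of that preimage from \<open>x\<close> linearly in \<open>r\<close>.\<close>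

lemma parallel_set_image_preimage:
  assumes T: "compact T" "T \<subseteq> G" and c: "c > 1" and u: "u > 0" "\<And>x. x \<in> T \<Longrightarrow> u \<le> s x"
  shows "\<forall>\<^sub>F r in at_right 0. \<forall>w\<in>parallel_set (\<phi> ` T) r.
           w \<in> \<phi> ` G \<and> g w \<in> parallel_set T (c / u * r)"
proof -
  obtain \<delta> where \<delta>: "\<delta> > 0" and ns:
    "\<And>x y. x \<in> T \<Longrightarrow> dist x y \<le> \<delta> \<Longrightarrow> s x * dist x y \<le> c * dist (\<phi> x) (\<phi> y)"
    using near_similarity[OF T c] by metis
  have cT: "compact (\<phi> ` T)" using T compact_image by blast
  obtain \<rho>1 where \<rho>1: "\<rho>1 > 0" "(\<Union>w\<in>\<phi> ` T. cball w \<rho>1) \<subseteq> \<phi> ` G"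
    using compact_subset_open_imp_cball_epsilon_subset[OF cT open_image_G] T by blast
  define N where "N = parallel_set (\<phi> ` T) \<rho>1"
  have N_iff: "w \<in> N \<longleftrightarrow> (\<exists>x\<in>T. dist (\<phi> x) w \<le> \<rho>1)" for w
    by (auto simp: N_def parallel_set_compact_iff cT)
  have N: "compact N" "N \<subseteq> \<phi> ` G"
    using compact_parallel_set[OF cT] \<rho>1 by (auto simp: N_def parallel_set_compact_iff cT)
  then have "uniformly_continuous_on N g"
    using continuous_on_g continuous_on_subset by (intro compact_uniformly_continuous) blast+
  then obtain \<rho>2 where \<rho>2: "\<rho>2 > 0"
    "\<And>w z. w \<in> N \<Longrightarrow> z \<in> N \<Longrightarrow> dist z w < \<rho>2 \<Longrightarrow> dist (g z) (g w) < \<delta>"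
    using \<delta> unfolding uniformly_continuous_on_def by metis
  have "min \<rho>1 (\<rho>2 / 2) > 0" using \<rho>1 \<rho>2 by simp
  from eventually_at_right_0_le[OF this] show ?thesis
  proof eventually_elim
    case (elim r)
    show ?case
    proof
      fix w assume "w \<in> parallel_set (\<phi> ` T) r"
      then obtain x where x: "x \<in> T" "dist (\<phi> x) w \<le> r"
        by (auto simp: parallel_set_compact_iff cT)
      have w: "w \<in> N" using x elim by (force simp: N_iff)
      have "\<phi> x \<in> N" using x \<rho>1 by (force simp: N_iff)
      then have "dist (g (\<phi> x)) (g w) < \<delta>" using w x elim \<rho>2(1) by (intro \<rho>2) auto
      moreover have "x \<in> G" using x T by blast
      ultimately have "dist x (g w) \<le> \<delta>" by simp
      moreover have wG: "w \<in> \<phi> ` G" using w N by blast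
      ultimately have "s x * dist x (g w) \<le> c * dist (\<phi> x) w"
        using ns[OF x(1), of "g w"] by (simp add: f_inv_into_f)
      also have "\<dots> \<le> c * r" using x c by simp
      finally have "s x * dist x (g w) \<le> c * r" .
      moreover have "u * dist x (g w) \<le> s x * dist x (g w)"
        using u x by (intro mult_right_mono) auto
      ultimately have "dist x (g w) \<le> c / u * r" using u by (simp add: field_simps)
      with x wG T show "w \<in> \<phi> ` G \<and> g w \<in> parallel_set T (c / u * r)"
        by (auto simp: parallel_set_compact_iff)
    qed
  qed
qed

lemma image_parallel_set_subset:
  assumes T: "compact T" "T \<subseteq> G" and c: "c > 1" and v: "v > 0" "\<And>x. x \<in> T \<Longrightarrow> s x \<le> v"
  shows "\<forall>\<^sub>F r in at_right 0. \<phi> ` parallel_set T (1 / (c * v) * r) \<subseteq> parallel_set (\<phi> ` T) r"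
proof -
  obtain \<delta> where \<delta>: "\<delta> > 0" and ns:
    "\<And>x y. x \<in> T \<Longrightarrow> dist x y \<le> \<delta> \<Longrightarrow> dist (\<phi> x) (\<phi> y) \<le> c * s x * dist x y"
    using near_similarity[OF T c] by metis
  have cT: "compact (\<phi> ` T)" using T compact_image by blast
  have k: "1 / (c * v) > 0" using c v by simp
  show ?thesis
    using eventually_at_right_0_scale[OF eventually_at_right_0_le[OF \<delta>] k]
  proof eventually_elim
    case (elim r)
    show ?case
    proof clarify
      fix y assume "y \<in> parallel_set T (1 / (c * v) * r)"
      then obtain x where x: "x \<in> T" "dist x y \<le> 1 / (c * v) * r"
        using T by (auto simp: parallel_set_compact_iff)
      then have "dist (\<phi> x) (\<phi> y) \<le> c * s x * dist x y" using ns elim by force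
      also have "\<dots> \<le> c * v * (1 / (c * v) * r)"
        using x v c T s_pos[of x] by (intro mult_mono) auto
      also have "\<dots> = r" using c v by simp
      finally show "\<phi> y \<in> parallel_set (\<phi> ` T) r"
        using x by (auto simp: parallel_set_compact_iff cT)
    qed
  qed
qed

text \<open>Three factors \<open>q\<close> in \<open>(q * (q * (q * u)))^n\<close> bound the volume distortion on the parallel set: one
  for the variation of \<open>s\<close> on \<open>T\<close>, one for its variation from \<open>T\<close> to the parallel set, one for the
  failure of \<open>\<phi>\<close> to be a similarity. The exponent \<open>4 * n\<close> is a convenient bound for this loss together
  with the one from changing the scale; only that it is fixed matters, since \<open>q\<close> tends to 1 in the
  end.\<close>

lemma cont_at_image_le:
  assumes T: "compact T" "T \<subseteq> G" and q: "q > 1" and u: "u > 0" and d: "d > 0"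
    and uq: "\<forall>x\<in>T. u \<le> s x \<and> s x \<le> q * u"
  shows "\<forall>\<^sub>F r in at_right 0. cont_at d (\<phi> ` T) r \<le>
           ennreal (q ^ (4 * CARD('n)) * u powr d) * cont_at d T (q / u * r)"
proof -
  let ?n = "CARD('n)"
  have k: "q / u > 0" using q u by simp
  have "\<forall>\<^sub>F r in at_right 0. \<forall>y\<in>parallel_set T r. y \<in> G \<and> u / q \<le> s y \<and> s y \<le> q * (q * u)"
    by (rule parallel_set_bounds[OF T q]) (use uq in blast)
  note scaled_bounds = eventually_at_right_0_scale[OF this k]
  have preimage: "\<forall>\<^sub>F r in at_right 0. \<forall>w\<in>parallel_set (\<phi> ` T) r.
      w \<in> \<phi> ` G \<and> g w \<in> parallel_set T (q / u * r)"
    by (rule parallel_set_image_preimage[OF T q u]) (use uq in blast)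
  show ?thesis
    using preimage scaled_bounds eventually_at_right_less[of 0]
  proof eventually_elim
    case (elim r)
    let ?E = "parallel_set T (q / u * r)" and ?e = "d - real ?n"
    have E: "compact ?E" "?E \<subseteq> G"
      using compact_parallel_set[OF T(1)] elim by auto
    have "parallel_set (\<phi> ` T) r \<subseteq> \<phi> ` ?E"
    proof
      fix w assume "w \<in> parallel_set (\<phi> ` T) r"
      then have "w = \<phi> (g w)" "g w \<in> ?E" using elim by (auto simp: f_inv_into_f)
      then show "w \<in> \<phi> ` ?E" by blast
    qed
    then have "emeasure lebesgue (parallel_set (\<phi> ` T) r) \<le> emeasure lebesgue (\<phi> ` ?E)"
      by (intro emeasure_mono compact_in_sets_lebesgue compact_image E)
    also have "\<dots> \<le> ennreal ((q * (q * (q * u))) ^ ?n) * emeasure lebesgue ?E"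
      using elim q u by (intro emeasure_image_le E) auto
    finally have "cont_at d (\<phi> ` T) r \<le>
        ennreal (r powr ?e) * (ennreal ((q * (q * (q * u))) ^ ?n) * emeasure lebesgue ?E)"
      unfolding cont_at_def by (intro mult_left_mono) auto
    also have "\<dots> = ennreal (r powr ?e * (q * (q * (q * u))) ^ ?n) * emeasure lebesgue ?E"
      using q u by (simp add: ennreal_mult mult.assoc)
    also have "\<dots> \<le> ennreal (q ^ (4 * ?n) * u powr d * (q / u * r) powr ?e) * emeasure lebesgue ?E"
    proof (intro mult_right_mono ennreal_leI)
      have "q ^ (4 * ?n) * u powr d * (q / u * r) powr ?e
          = q ^ (3 * ?n) * (q ^ ?n * q powr ?e) * (u powr d / u powr ?e) * r powr ?e"
        using q u elim by (simp add: powr_mult powr_divide power_add[symmetric])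
      also have "q ^ ?n * q powr ?e = q powr d"
        using q by (simp add: powr_realpow[symmetric] powr_add[symmetric])
      also have "u powr d / u powr ?e = u ^ ?n"
        using u by (simp add: powr_realpow[symmetric] powr_diff[symmetric])
      finally have rhs: "q ^ (4 * ?n) * u powr d * (q / u * r) powr ?e
          = q ^ (3 * ?n) * q powr d * u ^ ?n * r powr ?e" .
      have "q powr d \<ge> 1" using q d by (simp add: ge_one_powr_ge_zero)
      then have "q ^ (3 * ?n) * 1 * u ^ ?n * r powr ?e \<le> q ^ (3 * ?n) * q powr d * u ^ ?n * r powr ?e"
        using q u by (intro mult_right_mono mult_left_mono) auto
      moreover have "(q * (q * (q * u))) ^ ?n = q ^ (3 * ?n) * u ^ ?n"
        by (simp add: power_mult_distrib power_mult power3_eq_cube mult_ac)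
      ultimately show "r powr ?e * (q * (q * (q * u))) ^ ?n
          \<le> q ^ (4 * ?n) * u powr d * (q / u * r) powr ?e"
        unfolding rhs by (simp add: mult_ac)
    qed auto
    also have "\<dots> = ennreal (q ^ (4 * ?n) * u powr d) * cont_at d T (q / u * r)"
      unfolding cont_at_def using q by (simp add: ennreal_mult mult.assoc)
    finally show ?case .
  qed
qed

text \<open>The weight on the left is the largest value of \<open>s powr d\<close> on \<open>T\<close> allowed by the hypothesis, so that
  the limit of the left-hand side dominates the weighted measure of \<open>T\<close> once the content of \<open>T\<close>
  equals its measure.\<close>

lemma cont_at_image_ge:
  assumes T: "compact T" "T \<subseteq> G" and q: "q > 1" and u: "u > 0" and d: "d > 0"
    and uq: "\<forall>x\<in>T. u \<le> s x \<and> s x \<le> q * u"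
  shows "\<forall>\<^sub>F r in at_right 0. ennreal ((q * u) powr d) * cont_at d T (1 / (q * (q * u)) * r)
           \<le> ennreal (q ^ (4 * CARD('n))) * cont_at d (\<phi> ` T) r"
proof -
  let ?n = "CARD('n)"
  have k: "1 / (q * (q * u)) > 0" and qu: "q * u > 0" using q u by simp_all
  have "\<forall>\<^sub>F r in at_right 0. \<forall>y\<in>parallel_set T r. y \<in> G \<and> u / q \<le> s y \<and> s y \<le> q * (q * u)"
    by (rule parallel_set_bounds[OF T q]) (use uq in blast)
  note scaled_bounds = eventually_at_right_0_scale[OF this k]
  have subset: "\<forall>\<^sub>F r in at_right 0.
      \<phi> ` parallel_set T (1 / (q * (q * u)) * r) \<subseteq> parallel_set (\<phi> ` T) r"
    by (rule image_parallel_set_subset[OF T q qu]) (use uq in blast)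
  show ?thesis
    using subset scaled_bounds eventually_at_right_less[of 0]
  proof eventually_elim
    case (elim r)
    let ?E = "parallel_set T (1 / (q * (q * u)) * r)" and ?e = "d - real ?n"
    let ?P = "parallel_set (\<phi> ` T) r"
    have E: "compact ?E" "?E \<subseteq> G"
      using compact_parallel_set[OF T(1)] elim by auto
    have cT: "compact (\<phi> ` T)" using T compact_image by blast
    have "emeasure lebesgue ?E \<le> ennreal ((q / (u / q)) ^ ?n) * emeasure lebesgue (\<phi> ` ?E)"
      using elim q u by (intro emeasure_le_image E) auto
    also have "\<dots> \<le> ennreal ((q / (u / q)) ^ ?n) * emeasure lebesgue ?P"
      using elim by (intro mult_left_mono emeasure_mono compact_in_sets_lebesgue compact_parallel_set cT) auto
    finally have "ennreal ((q * u) powr d) * cont_at d T (1 / (q * (q * u)) * r) \<le>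
        ennreal ((q * u) powr d) * (ennreal ((1 / (q * (q * u)) * r) powr ?e) *
          (ennreal ((q / (u / q)) ^ ?n) * emeasure lebesgue ?P))"
      unfolding cont_at_def by (intro mult_left_mono) auto
    also have "\<dots> = ennreal ((q * u) powr d * (1 / (q * (q * u)) * r) powr ?e * (q / (u / q)) ^ ?n)
        * emeasure lebesgue ?P"
      using q u by (simp add: ennreal_mult mult.assoc)
    also have "\<dots> \<le> ennreal (q ^ (4 * ?n) * r powr ?e) * emeasure lebesgue ?P"
    proof (intro mult_right_mono ennreal_leI)
      have "(q * u) powr d * (1 / (q * (q * u)) * r) powr ?e * (q / (u / q)) ^ ?n
          = q powr d * (q ^ ?n / q powr ?e) * (q ^ ?n / q powr ?e)
            * (u powr d / u powr ?e / u ^ ?n) * r powr ?e"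
        using q u elim
        by (simp add: powr_mult powr_divide power_divide power_mult_distrib field_simps)
      also have "q ^ ?n / q powr ?e = q ^ (2 * ?n) / q powr d"
        using q by (simp add: powr_realpow[symmetric] powr_diff[symmetric])
      also have "u powr d / u powr ?e / u ^ ?n = 1"
        using u by (simp add: powr_realpow[symmetric] powr_diff[symmetric])
      also have "q powr d * (q ^ (2 * ?n) / q powr d) * (q ^ (2 * ?n) / q powr d) * 1 * r powr ?e
          = q ^ (4 * ?n) * r powr ?e / q powr d"
        using q by (simp add: power_add[symmetric])
      also have "\<dots> \<le> q ^ (4 * ?n) * r powr ?e / 1"
        using q d by (intro divide_left_mono) (auto simp: ge_one_powr_ge_zero)
      finally show "(q * u) powr d * (1 / (q * (q * u)) * r) powr ?e * (q / (u / q)) ^ ?n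
          \<le> q ^ (4 * ?n) * r powr ?e" by simp
    qed auto
    also have "\<dots> = ennreal (q ^ (4 * ?n)) * cont_at d (\<phi> ` T) r"
      unfolding cont_at_def using q by (simp add: ennreal_mult mult.assoc)
    finally show ?case .
  qed
qed

text \<open>By injectivity, a point near both images has a single preimage, which is near both \<open>A\<close> and \<open>B\<close>.
  So the overlap of the images lies in the image of an overlap at a proportional scale, and crude
  bounds for \<open>s\<close> suffice.\<close>

lemma cont_overlap_image_tendsto_0:
  assumes A: "compact A" "A \<subseteq> G" and B: "compact B" "B \<subseteq> G"
    and lim: "(cont_overlap d A B \<longlongrightarrow> 0) (at_right 0)"
  shows "(cont_overlap d (\<phi> ` A) (\<phi> ` B) \<longlongrightarrow> 0) (at_right 0)"
proof -
  let ?n = "CARD('n)"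
  have AB: "compact (A \<union> B)" "A \<union> B \<subseteq> G" using A B by auto
  obtain u v where u: "u > 0" and v: "v > 0" and uv: "\<And>x. x \<in> A \<union> B \<Longrightarrow> u \<le> s x \<and> s x \<le> v"
    using s_bounds[OF AB] by blast
  define k where "k = 2 / u"
  define C where "C = (2 * (2 * v)) ^ ?n / k powr (d - real ?n)"
  have k: "k > 0" using u by (simp add: k_def)
  have C: "C \<ge> 0" using v by (simp add: C_def)
  have pre_A: "\<forall>\<^sub>F r in at_right 0. \<forall>w\<in>parallel_set (\<phi> ` A) r.
      w \<in> \<phi> ` G \<and> g w \<in> parallel_set A (k * r)"
    unfolding k_def by (rule parallel_set_image_preimage[OF A _ u]) (use uv in auto)
  have pre_B: "\<forall>\<^sub>F r in at_right 0. \<forall>w\<in>parallel_set (\<phi> ` B) r.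
      w \<in> \<phi> ` G \<and> g w \<in> parallel_set B (k * r)"
    unfolding k_def by (rule parallel_set_image_preimage[OF B _ u]) (use uv in auto)
  have "\<forall>\<^sub>F r in at_right 0. \<forall>y\<in>parallel_set A r. y \<in> G \<and> u / 2 \<le> s y \<and> s y \<le> 2 * v"
    by (rule parallel_set_bounds[OF A]) (use uv in auto)
  note bounds = eventually_at_right_0_scale[OF this k]
  have le: "\<forall>\<^sub>F r in at_right 0. cont_overlap d (\<phi> ` A) (\<phi> ` B) r \<le> ennreal C * cont_overlap d A B (k * r)"
    using pre_A pre_B bounds eventually_at_right_less[of 0]
  proof eventually_elim
    case (elim r)
    let ?E = "parallel_set A (k * r) \<inter> parallel_set B (k * r)" and ?e = "d - real ?n"
    have E: "compact ?E" "?E \<subseteq> G"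
      using compact_parallel_set A B elim by (auto intro: compact_Int)
    have "parallel_set (\<phi> ` A) r \<inter> parallel_set (\<phi> ` B) r \<subseteq> \<phi> ` ?E"
    proof
      fix w assume "w \<in> parallel_set (\<phi> ` A) r \<inter> parallel_set (\<phi> ` B) r"
      then have "w = \<phi> (g w)" "g w \<in> ?E" using elim by (auto simp: f_inv_into_f)
      then show "w \<in> \<phi> ` ?E" by blast
    qed
    then have "emeasure lebesgue (parallel_set (\<phi> ` A) r \<inter> parallel_set (\<phi> ` B) r)
        \<le> emeasure lebesgue (\<phi> ` ?E)"
      by (intro emeasure_mono compact_in_sets_lebesgue compact_image E)
    also have "\<dots> \<le> ennreal ((2 * (2 * v)) ^ ?n) * emeasure lebesgue ?E"
      using elim v by (intro emeasure_image_le E) auto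
    finally have "cont_overlap d (\<phi> ` A) (\<phi> ` B) r \<le>
        ennreal (r powr ?e) * (ennreal ((2 * (2 * v)) ^ ?n) * emeasure lebesgue ?E)"
      unfolding cont_overlap_def by (intro mult_left_mono) auto
    also have "\<dots> = ennreal (r powr ?e * (2 * (2 * v)) ^ ?n) * emeasure lebesgue ?E"
      using v by (simp add: ennreal_mult mult.assoc)
    also have "r powr ?e * (2 * (2 * v)) ^ ?n = C * (k * r) powr ?e"
      using k elim by (simp add: C_def powr_mult)
    also have "ennreal (C * (k * r) powr ?e) * emeasure lebesgue ?E = ennreal C * cont_overlap d A B (k * r)"
      unfolding cont_overlap_def using C by (simp add: ennreal_mult mult.assoc)
    finally show ?case .
  qed
  have "((\<lambda>r. ennreal C * cont_overlap d A B (k * r)) \<longlongrightarrow> ennreal C * 0) (at_right 0)"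
    by (intro ennreal_tendsto_cmult tendsto_at_right_0_scale[OF lim k]) simp
  then show ?thesis
    using le by (intro tendsto_sandwich[OF _ le tendsto_const]) auto
qed

end

section \<open>Asymptotic bounds\<close>

text \<open>Lower and upper bounds, at scales \<open>r\<close> tending to 0, in a form which can be added along a
  decomposition: the lower bound tolerates an error \<open>e\<close> tending to 0, which absorbs the overlap of
  the parallel sets of two pieces and avoids subtraction in \<^typ>\<open>ennreal\<close>.\<close>

definition squeezed :: "(real \<Rightarrow> ennreal) \<Rightarrow> ennreal \<Rightarrow> ennreal \<Rightarrow> bool" where
  "squeezed f a b \<longleftrightarrow> (\<exists>h k e. (\<forall>\<^sub>F r in at_right 0. h r \<le> f r + e r \<and> f r \<le> k r) \<and>
     (h \<longlongrightarrow> a) (at_right 0) \<and> (k \<longlongrightarrow> b) (at_right 0) \<and> (e \<longlongrightarrow> 0) (at_right 0))"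

lemma squeezed_add:
  assumes "squeezed f a b" "squeezed f' a' b'"
    and sum: "\<And>r. f r + f' r = F r + w r" and w: "(w \<longlongrightarrow> 0) (at_right 0)"
  shows "squeezed F (a + a') (b + b')"
proof -
  obtain h k e where 1: "\<forall>\<^sub>F r in at_right 0. h r \<le> f r + e r \<and> f r \<le> k r"
    "(h \<longlongrightarrow> a) (at_right 0)" "(k \<longlongrightarrow> b) (at_right 0)" "(e \<longlongrightarrow> 0) (at_right 0)"
    using assms(1) unfolding squeezed_def by blast
  obtain h' k' e' where 2: "\<forall>\<^sub>F r in at_right 0. h' r \<le> f' r + e' r \<and> f' r \<le> k' r"
    "(h' \<longlongrightarrow> a') (at_right 0)" "(k' \<longlongrightarrow> b') (at_right 0)" "(e' \<longlongrightarrow> 0) (at_right 0)"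
    using assms(2) unfolding squeezed_def by blast
  show ?thesis
    unfolding squeezed_def
  proof (intro exI conjI)
    show "\<forall>\<^sub>F r in at_right 0. h r + h' r \<le> F r + (w r + (e r + e' r)) \<and> F r \<le> k r + k' r"
      using 1(1) 2(1)
    proof eventually_elim
      case (elim r)
      have "h r + h' r \<le> (f r + e r) + (f' r + e' r)" using elim by (intro add_mono) auto
      also have "\<dots> = (f r + f' r) + (e r + e' r)" by (simp add: ac_simps)
      also have "\<dots> = F r + (w r + (e r + e' r))" unfolding sum by (simp add: ac_simps)
      finally have "h r + h' r \<le> F r + (w r + (e r + e' r))" .
      moreover have "F r \<le> f r + f' r" unfolding sum by simp
      then have "F r \<le> k r + k' r" using elim by (meson add_mono order_trans)
      ultimately show ?case by blast
    qed
    show "((\<lambda>r. h r + h' r) \<longlongrightarrow> a + a') (at_right 0)" "((\<lambda>r. k r + k' r) \<longlongrightarrow> b + b') (at_right 0)"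
      by (intro tendsto_add 1 2)+
    show "((\<lambda>r. w r + (e r + e' r)) \<longlongrightarrow> 0) (at_right 0)"
      using tendsto_add[OF w tendsto_add[OF 1(4) 2(4)]] by simp
  qed
qed

text \<open>The case of the lower bound needs \<open>a < \<infinity>\<close> before the error \<open>e\<close> can be subtracted; this follows
  from \<open>a \<le> b \<le> q ^ N * I\<close>.\<close>

lemma tendsto_if_squeezed:
  assumes I: "I < \<infinity>"
    and sq: "\<And>q::real. q > 1 \<Longrightarrow>
      \<exists>a b. squeezed f a b \<and> I \<le> ennreal (q ^ N) * a \<and> b \<le> ennreal (q ^ N) * I"
  shows "(f \<longlongrightarrow> I) (at_right 0)"
proof (rule order_tendstoI)
  have lim: "((\<lambda>q. ennreal (q ^ N) * x) \<longlongrightarrow> x) (at_right 1)" if "x < \<infinity>" for x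
  proof -
    have "((\<lambda>q::real. q ^ N) \<longlongrightarrow> 1 ^ N) (at_right 1)" by (intro tendsto_intros)
    then have "((\<lambda>q. x * ennreal (q ^ N)) \<longlongrightarrow> x * ennreal (1 ^ N)) (at_right 1)"
      using that by (intro ennreal_tendsto_cmult tendsto_ennrealI) auto
    then show ?thesis by (simp add: mult.commute)
  qed
  fix x
  show "\<forall>\<^sub>F r in at_right 0. f r < x" if "I < x"
  proof -
    have "\<forall>\<^sub>F q in at_right 1. ennreal (q ^ N) * I < x \<and> 1 < q"
      using order_tendstoD(2)[OF lim[OF I] that] eventually_at_right_less by (rule eventually_conj)
    then obtain q :: real where q: "ennreal (q ^ N) * I < x" "1 < q"
      using eventually_happens by fastforce
    obtain a b where ab: "squeezed f a b" "b \<le> ennreal (q ^ N) * I" using sq[OF q(2)] by blast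
    obtain k where k: "\<forall>\<^sub>F r in at_right 0. f r \<le> k r" "(k \<longlongrightarrow> b) (at_right 0)"
      using ab(1) unfolding squeezed_def eventually_conj_iff by blast
    have "\<forall>\<^sub>F r in at_right 0. k r < x"
      using order_tendstoD(2)[OF k(2)] ab q by (meson le_less_trans)
    with k(1) show ?thesis by eventually_elim auto
  qed
  show "\<forall>\<^sub>F r in at_right 0. x < f r" if "x < I"
  proof -
    have "x < \<infinity>" using that I by (rule less_trans)
    have "\<forall>\<^sub>F q in at_right 1. ennreal (q ^ N) * x < I \<and> 1 < q"
      using order_tendstoD(2)[OF lim[OF \<open>x < \<infinity>\<close>] that] eventually_at_right_less by (rule eventually_conj)
    then obtain q :: real where q: "ennreal (q ^ N) * x < I" "1 < q"
      using eventually_happens by fastforce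
    obtain a b where ab: "squeezed f a b" "I \<le> ennreal (q ^ N) * a" "b \<le> ennreal (q ^ N) * I"
      using sq[OF q(2)] by blast
    obtain h k e where sq': "\<forall>\<^sub>F r in at_right 0. h r \<le> f r + e r \<and> f r \<le> k r"
      and h: "(h \<longlongrightarrow> a) (at_right 0)" and k: "(k \<longlongrightarrow> b) (at_right 0)" and e: "(e \<longlongrightarrow> 0) (at_right 0)"
      using ab(1) unfolding squeezed_def by blast
    have "a \<le> b + 0"
    proof (rule tendsto_le[OF _ tendsto_add[OF k e] h])
      show "\<forall>\<^sub>F r in at_right 0. h r \<le> k r + e r"
        using sq' by eventually_elim (meson add_right_mono order_trans)
    qed simp
    also have "\<dots> \<le> ennreal (q ^ N) * I" using ab by simp
    also have "\<dots> < \<infinity>" using I by (simp add: ennreal_mult_less_top)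
    finally have "a \<noteq> top" by simp
    have "x < a"
      using q ab by (metis less_le_trans mult_left_mono not_le zero_le)
    moreover have "((\<lambda>r. h r - e r) \<longlongrightarrow> a - 0) (at_right 0)"
      using \<open>a \<noteq> top\<close> by (intro tendsto_diff_ennreal h e) auto
    ultimately have "\<forall>\<^sub>F r in at_right 0. x < h r - e r"
      by (intro order_tendstoD(1)) auto
    moreover have "\<forall>\<^sub>F r in at_right 0. e r < \<infinity>"
      using e by (rule order_tendstoD) simp
    ultimately show ?thesis
      using sq'
    proof eventually_elim
      case (elim r)
      then have "h r - e r \<le> f r" by (auto simp: ennreal_minus_le_iff add.commute)
      with elim show ?case by simp
    qed
  qed
qed

section \<open>The weighted measure on level slices of the conformal factor\<close>

locale conformal_content = conformal_embedding G \<phi>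
  for G :: "(real^'n) set" and \<phi> +
  fixes S :: "(real^'n) set" and \<mu> :: "(real^'n) measure" and d :: real
  assumes content: "minkowski_content_measure d S \<mu>" and S_G: "S \<subseteq> G" and d: "d > 0"
begin

abbreviation D :: "(real^'n) measure" where
  "D \<equiv> density \<mu> (\<lambda>x. ennreal (s x powr d))"

lemma sets_\<mu>: "sets \<mu> = sets (restrict_space borel S)"
  using content by (simp add: minkowski_content_measure_def)

lemma space_\<mu>: "space \<mu> = S"
  using sets_eq_imp_space_eq[OF sets_\<mu>] by (simp add: space_restrict_space)

lemma compact_in_sets: "compact K \<Longrightarrow> K \<subseteq> S \<Longrightarrow> K \<in> sets \<mu>"
  unfolding sets_\<mu> sets_restrict_space
  by (metis borel_compact image_eqI inf.absorb_iff2)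

lemma emeasure_compact_finite: "compact K \<Longrightarrow> K \<subseteq> S \<Longrightarrow> emeasure \<mu> K < \<infinity>"
  using content by (simp add: minkowski_content_measure_def)

lemma rel_boundary_in_sets: "rel_boundary S K \<in> sets \<mu>"
  unfolding sets_\<mu> sets_restrict_space rel_boundary_def Int_assoc
  by (intro imageI sets.Int borel_closed closed_closure)

lemma s_measurable [measurable]: "s \<in> borel_measurable \<mu>"
  using continuous_on_subset[OF continuous_on_s S_G]
  by (simp add: measurable_cong_sets[OF sets_\<mu> refl] borel_measurable_continuous_on_restrict)

lemma emeasure_D_bounds:
  assumes T: "T \<in> sets \<mu>" and u: "u > 0" and uv: "\<And>x. x \<in> T \<Longrightarrow> u \<le> s x \<and> s x \<le> v"
  shows "ennreal (u powr d) * emeasure \<mu> T \<le> emeasure D T"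
    and "emeasure D T \<le> ennreal (v powr d) * emeasure \<mu> T"
proof -
  have D: "emeasure D T = (\<integral>\<^sup>+x. ennreal (s x powr d) * indicator T x \<partial>\<mu>)"
    using T by (intro emeasure_density) auto
  have le: "u powr d \<le> s x powr d \<and> s x powr d \<le> v powr d" if "x \<in> T" for x
    using uv[OF that] u d by (intro conjI powr_mono2) auto
  have "(\<integral>\<^sup>+x. ennreal (u powr d) * indicator T x \<partial>\<mu>) \<le> emeasure D T"
    unfolding D by (rule nn_integral_mono) (simp add: indicator_def ennreal_leI le)
  moreover have "emeasure D T \<le> (\<integral>\<^sup>+x. ennreal (v powr d) * indicator T x \<partial>\<mu>)"
    unfolding D by (rule nn_integral_mono) (simp add: indicator_def ennreal_leI le)
  ultimately show "ennreal (u powr d) * emeasure \<mu> T \<le> emeasure D T"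
    and "emeasure D T \<le> ennreal (v powr d) * emeasure \<mu> T"
    using T by (simp_all add: nn_integral_cmult_indicator)
qed

lemma emeasure_D_null_iff:
  assumes "A \<in> sets \<mu>"
  shows "emeasure D A = 0 \<longleftrightarrow> emeasure \<mu> A = 0"
proof -
  have "A \<in> null_sets D \<longleftrightarrow> (AE x in \<mu>. x \<in> A \<longrightarrow> ennreal (s x powr d) = 0)"
    using assms by (subst null_sets_density_iff) auto
  also have "\<dots> \<longleftrightarrow> (AE x in \<mu>. x \<notin> A)"
  proof (rule AE_cong)
    fix x assume "x \<in> space \<mu>"
    then have "s x > 0" using s_pos S_G space_\<mu> by auto
    then show "(x \<in> A \<longrightarrow> ennreal (s x powr d) = 0) \<longleftrightarrow> x \<notin> A" by simp
  qed
  also have "\<dots> \<longleftrightarrow> A \<in> null_sets \<mu>" using assms by (simp add: AE_iff_null_sets)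
  finally show ?thesis using assms by (simp add: null_sets_def)
qed

lemma emeasure_D_compact_finite:
  assumes "compact K" "K \<subseteq> S"
  shows "emeasure D K < \<infinity>"
proof -
  obtain u v where "u > 0" "\<And>x. x \<in> K \<Longrightarrow> u \<le> s x \<and> s x \<le> v"
    using s_bounds[OF assms(1) subset_trans[OF assms(2) S_G]] by blast
  from emeasure_D_bounds(2)[OF compact_in_sets[OF assms] this]
  show ?thesis
  proof (rule le_less_trans)
    show "ennreal (v powr d) * emeasure \<mu> K < \<infinity>"
      using emeasure_compact_finite[OF assms] by (metis ennreal_less_top ennreal_mult_less_top infinity_ennreal_def)
  qed
qed

lemma compact_slice:
  assumes "compact L" "L \<subseteq> S"
  shows "compact (L \<inter> s -` {lo..hi})"
proof -
  have "continuous_on L s"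
    using continuous_on_subset[OF continuous_on_s] assms(2) S_G by simp
  then have "closed (L \<inter> s -` {lo..hi})"
    using compact_imp_closed[OF assms(1)] by (rule continuous_closed_preimage) simp
  from compact_Int_closed[OF assms(1) this] show ?thesis
    by (simp add: Int_assoc[symmetric])
qed

text \<open>Where \<open>lo < s x < hi\<close>, a small neighbourhood of \<open>x\<close> cannot tell the slice from \<open>L\<close>. So slicing
  creates new boundary only on the two level sets.\<close>

lemma rel_boundary_slice:
  assumes L: "compact L" "L \<subseteq> S"
  shows "rel_boundary S (L \<inter> s -` {lo..hi}) \<subseteq> rel_boundary S L \<union> L \<inter> s -` {lo} \<union> L \<inter> s -` {hi}"
proof
  let ?T = "L \<inter> s -` {lo..hi}"
  fix x assume x: "x \<in> rel_boundary S ?T"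
  then have xS: "x \<in> S" and xT: "x \<in> ?T" and x_cl: "x \<in> closure (S - ?T)"
    using closure_closed[OF compact_imp_closed[OF compact_slice[OF L, of lo hi]]]
    by (auto simp: rel_boundary_def)
  show "x \<in> rel_boundary S L \<union> L \<inter> s -` {lo} \<union> L \<inter> s -` {hi}"
  proof (cases "s x = lo \<or> s x = hi")
    case False
    then have sx: "lo < s x" "s x < hi" using xT by auto
    have "x \<in> closure (S - L)"
      unfolding closure_approachable
    proof (intro allI impI)
      fix e :: real assume e: "e > 0"
      define \<epsilon> where "\<epsilon> = min (s x - lo) (hi - s x)"
      have "\<epsilon> > 0" using sx by (simp add: \<epsilon>_def)
      then obtain \<delta> where \<delta>: "\<delta> > 0" "\<And>y. y \<in> G \<Longrightarrow> dist y x < \<delta> \<Longrightarrow> dist (s y) (s x) < \<epsilon>"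
        using continuous_on_s xS S_G unfolding continuous_on_iff by (meson subsetD)
      have "min e \<delta> > 0" using e \<delta> by simp
      then obtain y where y: "y \<in> S - ?T" "dist y x < min e \<delta>"
        using x_cl unfolding closure_approachable by blast
      then have "dist (s y) (s x) < \<epsilon>" using \<delta>(2)[of y] S_G by auto
      then have "s y \<in> {lo..hi}" by (auto simp: \<epsilon>_def dist_real_def)
      with y show "\<exists>y\<in>S - L. dist y x < e" by auto
    qed
    moreover have "x \<in> closure L" using xT closure_subset by blast
    ultimately show ?thesis using xS by (simp add: rel_boundary_def)
  qed (use xT in auto)
qed

lemma has_content_slice:
  assumes L: "compact L" "L \<subseteq> S" "emeasure \<mu> (rel_boundary S L) = 0"
    and "emeasure \<mu> (L \<inter> s -` {lo}) = 0" "emeasure \<mu> (L \<inter> s -` {hi}) = 0"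
  shows "has_minkowski_content d (L \<inter> s -` {lo..hi}) (emeasure \<mu> (L \<inter> s -` {lo..hi}))"
proof -
  have level: "L \<inter> s -` {t} \<in> sets \<mu>" for t
    using compact_slice[OF L(1,2), of t t] L(2) by (intro compact_in_sets) auto
  let ?B = "rel_boundary S L \<union> L \<inter> s -` {lo} \<union> L \<inter> s -` {hi}"
  have "?B \<in> null_sets \<mu>"
    using assms level rel_boundary_in_sets by (intro null_sets.Un) (auto simp: null_sets_def)
  then have "emeasure \<mu> (rel_boundary S (L \<inter> s -` {lo..hi})) = 0"
    using null_sets_subset[OF _ rel_boundary_in_sets rel_boundary_slice[OF L(1,2)]]
    by (auto simp: null_sets_def)
  then show ?thesis
    using content compact_slice[OF L(1,2), of lo hi] L(2)
    unfolding minkowski_content_measure_def by auto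
qed

text \<open>The levels of positive measure are the atoms of a finite measure on the line, the distribution
  of \<open>s\<close> on \<open>L\<close>.\<close>

lemma countable_heavy_levels:
  assumes L: "compact L" "L \<subseteq> S"
  shows "countable {t. emeasure \<mu> (L \<inter> s -` {t}) \<noteq> 0}"
proof -
  let ?\<mu>L = "restrict_space \<mu> L"
  have L\<mu>: "L \<inter> space \<mu> \<in> sets \<mu>" "L \<in> sets \<mu>" "L \<inter> space \<mu> = L"
    using compact_in_sets[OF L] L(2) space_\<mu> by (auto simp: Int_absorb2)
  have [measurable]: "s \<in> borel_measurable ?\<mu>L"
    by (rule measurable_restrict_space1[OF s_measurable])
  interpret \<mu>L: finite_measure ?\<mu>L
    using L\<mu> emeasure_compact_finite[OF L]
    by (intro finite_measureI) (simp add: space_restrict_space emeasure_restrict_space)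
  interpret distr: finite_measure "distr ?\<mu>L borel s"
    by (rule \<mu>L.finite_measure_distr) measurable
  have "emeasure \<mu> (L \<inter> s -` {t}) = emeasure (distr ?\<mu>L borel s) {t}" for t
    using L\<mu>
    by (subst emeasure_distr) (auto simp: space_restrict_space emeasure_restrict_space Int_ac)
  then show ?thesis
    using distr.countable_support by (simp add: distr.emeasure_eq_measure)
qed

text \<open>A geometric progression through the range of \<open>s\<close> meets the countably many heavy levels only
  for countably many starting points.\<close>

lemma null_geometric_levels:
  assumes L: "compact L" "L \<subseteq> S" and q: "q > 1" and u: "u > 0"
  obtains t where "0 < t" "t < u" "\<And>i::nat. emeasure \<mu> (L \<inter> s -` {t * q ^ i}) = 0"
proof -
  let ?H = "{t. emeasure \<mu> (L \<inter> s -` {t}) \<noteq> 0}"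
  have "countable (\<Union>i::nat. (\<lambda>t. t / q ^ i) ` ?H)"
    using countable_heavy_levels[OF L] by auto
  then obtain t where t: "t \<in> {0<..<u}" "t \<notin> (\<Union>i::nat. (\<lambda>t. t / q ^ i) ` ?H)"
    using open_minus_countable[of _ "{0<..<u}"] u by (metis greaterThanLessThan_empty_iff not_le open_greaterThanLessThan)
  have "emeasure \<mu> (L \<inter> s -` {t * q ^ i}) = 0" for i
  proof (rule ccontr)
    assume "emeasure \<mu> (L \<inter> s -` {t * q ^ i}) \<noteq> 0"
    then have "t * q ^ i / q ^ i \<in> (\<lambda>t. t / q ^ i) ` ?H" by blast
    moreover have "t * q ^ i / q ^ i = t" using q by simp
    ultimately show False using t(2) by auto
  qed
  with t show ?thesis by (intro that) auto
qed

lemma squeezed_image_slice: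
  assumes T: "compact T" "T \<subseteq> S" and q: "q > 1" and u: "u > 0"
    and uq: "\<forall>x\<in>T. u \<le> s x \<and> s x \<le> q * u"
    and cont: "has_minkowski_content d T (emeasure \<mu> T)"
  shows "\<exists>a b. squeezed (cont_at d (\<phi> ` T)) a b \<and>
    emeasure D T \<le> ennreal (q ^ (4 * CARD('n))) * a \<and> b \<le> ennreal (q ^ (4 * CARD('n))) * emeasure D T"
proof -
  let ?Q = "q ^ (4 * CARD('n))"
  have TG: "T \<subseteq> G" using T S_G by blast
  have Q: "?Q > 0" using q by simp
  define \<alpha> where "\<alpha> = (q * u) powr d / ?Q"
  define \<beta> where "\<beta> = ?Q * u powr d"
  define a where "a = ennreal \<alpha> * emeasure \<mu> T"
  define b where "b = ennreal \<beta> * emeasure \<mu> T"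
  have lim: "((\<lambda>r. cont_at d T (k * r)) \<longlongrightarrow> emeasure \<mu> T) (at_right 0)" if "k > 0" for k
    using cont that unfolding has_minkowski_content_def by (rule tendsto_at_right_0_scale)
  have "squeezed (cont_at d (\<phi> ` T)) a b"
    unfolding squeezed_def a_def b_def
  proof (intro exI conjI)
    show "\<forall>\<^sub>F r in at_right 0.
        ennreal \<alpha> * cont_at d T (1 / (q * (q * u)) * r) \<le> cont_at d (\<phi> ` T) r + 0 \<and>
        cont_at d (\<phi> ` T) r \<le> ennreal \<beta> * cont_at d T (q / u * r)"
      using cont_at_image_ge[OF T(1) TG q u d uq] cont_at_image_le[OF T(1) TG q u d uq]
    proof eventually_elim
      case (elim r)
      have "ennreal \<alpha> * cont_at d T (1 / (q * (q * u)) * r) =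
          ennreal (1 / ?Q) * (ennreal ((q * u) powr d) * cont_at d T (1 / (q * (q * u)) * r))"
        using Q q by (simp add: \<alpha>_def ennreal_mult[symmetric] mult.assoc[symmetric])
      also have "\<dots> \<le> ennreal (1 / ?Q) * (ennreal ?Q * cont_at d (\<phi> ` T) r)"
        using elim by (intro mult_left_mono) auto
      also have "\<dots> = cont_at d (\<phi> ` T) r"
        using Q q by (simp add: ennreal_mult[symmetric] mult.assoc[symmetric])
      finally show ?case using elim by (simp add: \<beta>_def)
    qed
    show "((\<lambda>r. ennreal \<alpha> * cont_at d T (1 / (q * (q * u)) * r)) \<longlongrightarrow> ennreal \<alpha> * emeasure \<mu> T) (at_right 0)"
      "((\<lambda>r. ennreal \<beta> * cont_at d T (q / u * r)) \<longlongrightarrow> ennreal \<beta> * emeasure \<mu> T) (at_right 0)"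
      using q u by (intro ennreal_tendsto_cmult lim; simp)+
  qed (rule tendsto_const)
  moreover have "emeasure D T \<le> ennreal ?Q * a"
    using emeasure_D_bounds(2)[OF compact_in_sets[OF T] u uq[rule_format]] Q q
    by (simp add: a_def \<alpha>_def mult.assoc[symmetric] ennreal_mult[symmetric])
  moreover have "b \<le> ennreal ?Q * emeasure D T"
    using emeasure_D_bounds(1)[OF compact_in_sets[OF T] u uq[rule_format]] Q q
    by (simp add: b_def \<beta>_def ennreal_mult mult.assoc mult_left_mono)
  ultimately show ?thesis by blast
qed

text \<open>Induction along the levels \<open>t i\<close>: the set below level \<open>t (m + 1)\<close> is the union of the set below
  \<open>t m\<close> and one slice, which meet in a null level. The progression starts below the minimum of \<open>s\<close> on
  \<open>L\<close>, where the set is empty, and exhausts \<open>L\<close> after finitely many steps.\<close>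

lemma squeezed_image:
  assumes L: "compact L" "L \<subseteq> S" "emeasure \<mu> (rel_boundary S L) = 0" and q: "q > 1"
  shows "\<exists>a b. squeezed (cont_at d (\<phi> ` L)) a b \<and>
    emeasure D L \<le> ennreal (q ^ (4 * CARD('n))) * a \<and> b \<le> ennreal (q ^ (4 * CARD('n))) * emeasure D L"
proof -
  let ?Q = "ennreal (q ^ (4 * CARD('n)))"
  have LG: "L \<subseteq> G" using L S_G by blast
  obtain u v where u: "u > 0" and v: "v > 0" and uv: "\<And>x. x \<in> L \<Longrightarrow> u \<le> s x \<and> s x \<le> v"
    using s_bounds[OF L(1) LG] by blast
  obtain t0 where t0: "0 < t0" "t0 < u" and null: "\<And>i::nat. emeasure \<mu> (L \<inter> s -` {t0 * q ^ i}) = 0"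
    using null_geometric_levels[OF L(1,2) q u] by blast
  define t where "t i = t0 * q ^ i" for i :: nat
  define A where "A i = L \<inter> s -` {0..t i}" for i
  define T where "T i = L \<inter> s -` {t i..t (Suc i)}" for i
  have t_pos: "t i > 0" for i using t0 q by (simp add: t_def)
  have t_Suc: "t (Suc i) = q * t i" for i by (simp add: t_def)
  have t_less: "t i < t (Suc i)" for i using t_pos[of i] q by (simp add: t_Suc)
  have "L \<inter> s -` {0} = {}" using uv u by force
  then have null': "emeasure \<mu> (L \<inter> s -` {0}) = 0" "emeasure \<mu> (L \<inter> s -` {t i}) = 0" for i
    using null by (simp_all add: t_def)
  have A: "compact (A i)" "A i \<subseteq> S" and T: "compact (T i)" "T i \<subseteq> S" for i
    using compact_slice[OF L(1,2)] L(2) by (auto simp: A_def T_def)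
  have contA: "has_minkowski_content d (A i) (emeasure \<mu> (A i))"
    and contT: "has_minkowski_content d (T i) (emeasure \<mu> (T i))" for i
    unfolding A_def T_def by (intro has_content_slice L null')+
  have Un: "A i \<union> T i = A (Suc i)" and Int: "A i \<inter> T i = L \<inter> s -` {t i}" for i
    using t_less[of i] t_pos[of i] by (auto simp: A_def T_def)
  have "\<exists>a b. squeezed (cont_at d (\<phi> ` A m)) a b \<and> emeasure D (A m) \<le> ?Q * a \<and> b \<le> ?Q * emeasure D (A m)" for m
  proof (induction m)
    case 0
    have A0: "A 0 = {}" using uv t0 by (force simp: A_def t_def)
    have "squeezed (cont_at d (\<phi> ` A 0)) 0 0"
      unfolding squeezed_def
      by (rule exI[of _ "\<lambda>_. 0"])+ (simp add: A0 cont_at_def parallel_set_def)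
    then show ?case using A0 by (intro exI[of _ 0]) auto
  next
    case (Suc m)
    then obtain a b where ab: "squeezed (cont_at d (\<phi> ` A m)) a b"
      "emeasure D (A m) \<le> ?Q * a" "b \<le> ?Q * emeasure D (A m)" by blast
    have "\<forall>x\<in>T m. t m \<le> s x \<and> s x \<le> q * t m" by (auto simp: T_def t_Suc)
    then obtain a' b' where ab': "squeezed (cont_at d (\<phi> ` T m)) a' b'"
      "emeasure D (T m) \<le> ?Q * a'" "b' \<le> ?Q * emeasure D (T m)"
      using squeezed_image_slice[OF T q t_pos _ contT] by blast
    have sets: "A m \<in> sets \<mu>" "T m \<in> sets \<mu>" by (intro compact_in_sets A T)+
    have add_\<mu>: "emeasure \<mu> (A m) + emeasure \<mu> (T m) = emeasure \<mu> (A (Suc m))"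
      using emeasure_Un_Int[OF sets] by (simp add: Un Int null')
    have "emeasure D (A m \<inter> T m) = 0"
      using emeasure_D_null_iff[OF sets.Int[OF sets]] by (simp add: Int null')
    then have add_D: "emeasure D (A m) + emeasure D (T m) = emeasure D (A (Suc m))"
      using emeasure_Un_Int[of "A m" D "T m"] sets by (simp add: Un)
    have "(cont_overlap d (A m) (T m) \<longlongrightarrow> 0) (at_right 0)"
    proof (rule cont_overlap_tendsto_0[OF A(1) T(1) contA contT])
      show "has_minkowski_content d (A m \<union> T m) (emeasure \<mu> (A m) + emeasure \<mu> (T m))"
        using contA[of "Suc m"] by (simp add: Un add_\<mu>)
    qed (intro emeasure_compact_finite A T)+
    then have overlap: "(cont_overlap d (\<phi> ` A m) (\<phi> ` T m) \<longlongrightarrow> 0) (at_right 0)"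
      by (intro cont_overlap_image_tendsto_0 A T subset_trans[OF A(2) S_G] subset_trans[OF T(2) S_G])
    have "compact (\<phi> ` A m)" "compact (\<phi> ` T m)"
      by (intro compact_image A T subset_trans[OF A(2) S_G] subset_trans[OF T(2) S_G])+
    then have "cont_at d (\<phi> ` A m) r + cont_at d (\<phi> ` T m) r =
        cont_at d (\<phi> ` A (Suc m)) r + cont_overlap d (\<phi> ` A m) (\<phi> ` T m) r" for r
      unfolding Un[symmetric] image_Un by (rule cont_at_add_eq)
    with ab(1) ab'(1) have "squeezed (cont_at d (\<phi> ` A (Suc m))) (a + a') (b + b')"
      using overlap by (rule squeezed_add)
    moreover have "emeasure D (A (Suc m)) \<le> ?Q * (a + a')" "b + b' \<le> ?Q * emeasure D (A (Suc m))"
      unfolding add_D[symmetric] distrib_left by (intro add_mono ab ab')+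
    ultimately show ?case by blast
  qed
  moreover obtain m where "v / t0 < q ^ m" using real_arch_pow[OF q] by blast
  then have "v \<le> t m" using t0 by (simp add: t_def field_simps)
  then have "A m = L" using uv u by (force simp: A_def)
  ultimately show ?thesis by metis
qed

lemma has_content_image:
  assumes "compact L" "L \<subseteq> S" "emeasure \<mu> (rel_boundary S L) = 0"
  shows "has_minkowski_content d (\<phi> ` L) (emeasure D L)"
  unfolding has_minkowski_content_def
  using emeasure_D_compact_finite[OF assms(1,2)] squeezed_image[OF assms]
  by (rule tendsto_if_squeezed)

text \<open>For the compact subset \<open>K = \<phi> ` L\<close> of \<open>\<phi> ` S\<close> this lets the null boundary of \<open>K\<close> be pulled back
  to \<open>L\<close>.\<close>

lemma image_rel_boundary_subset:
  assumes "L \<subseteq> S"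
  shows "\<phi> ` rel_boundary S L \<subseteq> rel_boundary (\<phi> ` S) (\<phi> ` L)"
proof clarify
  have closure: "\<phi> x \<in> closure (\<phi> ` B)" if B: "x \<in> closure B" "B \<subseteq> S" "x \<in> S" for x B
  proof -
    obtain y where y: "\<And>n. y n \<in> B" "y \<longlonglongrightarrow> x"
      using B(1) unfolding closure_sequential by blast
    have "(\<lambda>n. \<phi> (y n)) \<longlonglongrightarrow> \<phi> x"
    proof (rule continuous_on_tendsto_compose[OF continuous_on_\<phi> y(2)])
      show "x \<in> G" using B S_G by blast
      show "\<forall>\<^sub>F n in sequentially. y n \<in> G" using y(1) B S_G by (intro always_eventually) blast
    qed
    then show ?thesis
      unfolding closure_sequential using y(1) by (intro exI[of _ "\<lambda>n. \<phi> (y n)"]) auto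
  qed
  fix x assume x: "x \<in> rel_boundary S L"
  have "\<phi> ` (S - L) = \<phi> ` S - \<phi> ` L"
    using inj_on_subset[OF inj S_G] assms by (simp add: inj_on_image_set_diff)
  then show "\<phi> x \<in> rel_boundary (\<phi> ` S) (\<phi> ` L)"
    using x closure[of x L] closure[of x "S - L"] assms by (auto simp: rel_boundary_def)
qed

end

section \<open>Conformal images of content measures\<close>

context conformal_embedding
begin

lemma locally_closed_image:
  assumes "closedin (top_of_set G) S"
  shows "\<phi> ` S \<in> locally_closed_sets"
proof -
  obtain C where C: "closed C" "S = G \<inter> C"
    using assms unfolding closedin_closed by blast
  have "\<phi> ` S = \<phi> ` G \<inter> g -` C"
    using C inj by (auto simp: image_iff)
  moreover have "closedin (top_of_set (\<phi> ` G)) (\<phi> ` G \<inter> g -` C)"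
    using continuous_on_g C(1) by (rule continuous_closedin_preimage)
  ultimately obtain C' where "closed C'" "\<phi> ` S = \<phi> ` G \<inter> C'"
    unfolding closedin_closed by auto
  then show ?thesis
    using open_image_G by (auto simp: locally_closed_sets_def)
qed

end

context conformal_content
begin

abbreviation \<nu> :: "(real^'n) measure" where
  "\<nu> \<equiv> distr D (restrict_space borel (\<phi> ` S)) \<phi>"

lemma \<phi>_measurable: "\<phi> \<in> measurable D (restrict_space borel (\<phi> ` S))"
proof (rule measurable_restrict_space2)
  show "\<phi> \<in> space D \<rightarrow> \<phi> ` S" by (simp add: space_\<mu>)
  have "continuous_on S \<phi>" using continuous_on_\<phi> S_G by (rule continuous_on_subset)
  then have "\<phi> \<in> borel_measurable (restrict_space borel S)"
    by (rule borel_measurable_continuous_on_restrict)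
  moreover have "sets D = sets (restrict_space borel S)" by (simp add: sets_\<mu>)
  ultimately show "\<phi> \<in> borel_measurable D"
    by (simp only: measurable_cong_sets[of D, OF _ refl])
qed

lemma minkowski_content_measure_image:
  assumes "\<phi> ` S \<in> locally_closed_sets"
  shows "minkowski_content_measure d (\<phi> ` S) \<nu>"
  unfolding minkowski_content_measure_def
proof (intro conjI allI impI)
  show "sets \<nu> = sets (restrict_space borel (\<phi> ` S))" by simp
  fix K assume K: "compact K \<and> K \<subseteq> \<phi> ` S"
  define L where "L = g ` K"
  have "K \<subseteq> \<phi> ` G" using K S_G by blast
  have L_S: "L \<subseteq> S"
  proof
    fix x assume "x \<in> L"
    then obtain w where "w \<in> K" "x = g w" by (auto simp: L_def)
    moreover from this K obtain y where "y \<in> S" "w = \<phi> y" by blast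
    ultimately show "x \<in> S" using S_G by auto
  qed
  have \<phi>L: "\<phi> ` L = K" using \<open>K \<subseteq> \<phi> ` G\<close> by (force simp: L_def image_image f_inv_into_f)
  have compact_L: "compact L"
    unfolding L_def
    using K continuous_on_subset[OF continuous_on_g \<open>K \<subseteq> \<phi> ` G\<close>] by (blast intro: compact_continuous_image)
  have preimage: "\<phi> -` \<phi> ` B \<inter> S = B" if "B \<subseteq> S" for B
    using inj_on_subset[OF inj S_G] that by (auto dest: inj_onD)
  have "K \<in> sets (restrict_space borel (\<phi> ` S))"
    unfolding sets_restrict_space using K by (metis borel_compact image_eqI inf.absorb_iff2)
  then have \<nu>K: "emeasure \<nu> K = emeasure D L"
    using preimage[OF L_S] by (simp add: emeasure_distr[OF \<phi>_measurable] space_\<mu> \<phi>L)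
  show "emeasure \<nu> K < \<infinity>"
    unfolding \<nu>K by (rule emeasure_D_compact_finite[OF compact_L L_S])
  show "has_minkowski_content d K (emeasure \<nu> K)" if null: "emeasure \<nu> (rel_boundary (\<phi> ` S) K) = 0"
  proof -
    let ?B = "rel_boundary (\<phi> ` S) K"
    have B: "?B \<in> sets (restrict_space borel (\<phi> ` S))"
      unfolding sets_restrict_space rel_boundary_def Int_assoc
      by (intro imageI sets.Int borel_closed closed_closure)
    have "rel_boundary S L \<subseteq> \<phi> -` ?B \<inter> S"
      using image_rel_boundary_subset[OF L_S] by (auto simp: \<phi>L rel_boundary_def)
    moreover have "\<phi> -` ?B \<inter> S \<in> sets D"
      using measurable_sets[OF \<phi>_measurable B] by (simp add: space_\<mu>)
    ultimately have "emeasure D (rel_boundary S L) \<le> emeasure D (\<phi> -` ?B \<inter> S)"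
      by (rule emeasure_mono)
    also have "\<dots> = 0"
      using null B by (simp add: emeasure_distr[OF \<phi>_measurable] space_\<mu>)
    finally have "emeasure \<mu> (rel_boundary S L) = 0"
      using emeasure_D_null_iff[OF rel_boundary_in_sets] by simp
    from has_content_image[OF compact_L L_S this] show ?thesis
      by (simp add: \<phi>L \<nu>K)
  qed
qed (rule assms)

end

theorem theorem6p13:
  fixes d :: real
    and S G :: "(real^'n) set"
    and \<mu> :: "(real^'n) measure"
    and \<phi> :: "real^'n \<Rightarrow> real^'n"
  assumes "0 < d" and "d < real CARD('n)"
    and "S \<in> locally_closed_sets"
    and "minkowski_content_measure d S \<mu>"
    and "open G" and "closedin (top_of_set G) S"
    and "conformal_on G \<phi>" and "inj_on \<phi> G"
  shows "minkowski_content_measure d (\<phi> ` S)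
           (distr (density \<mu> (\<lambda>x. ennreal (conformal_factor \<phi> x powr d)))
              (restrict_space borel (\<phi> ` S)) \<phi>)"
proof -
  have "S \<subseteq> G" using assms(6) by (simp add: closedin_subset_trans closedin_imp_subset)
  interpret conformal_content G \<phi> S \<mu> d
    using assms \<open>S \<subseteq> G\<close> by unfold_locales
  show ?thesis
    by (rule minkowski_content_measure_image[OF locally_closed_image[OF assms(6)]])
qed

end
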